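(* For every $\varepsilon>0$ there exists $C>0$ such that the following holds. If $p=p(n)\geq Cn^{-1/2}$ and $G\sim\mathbb{G}(n,p)$, then with high probability \[ Rt(K_3,G)\geq \frac{n}{5}-\varepsilon n. \]
   Context: $\mathbb{G}(n,p)$ is the binomial random graph on $n$ vertices where each edge is present independently with probability $p$; "with high probability" means with probability tending to $1$ as $n\to\infty$. A $K_3$-tiling is a collection of vertex-disjoint triangles; its size is the number of triangles. $Rt(K_3,G)$ is the largest integer $m$ such that for every $2$-colouring (red/blue) of the edges of $G$ there are $m$ vertex-disjoint triangles in $G$ which are all monochromatic of the same colour. *)

theory Defs
  imports "HOL-Probability.Probability"
begin

text \<open>A graph on the vertex set \<open>{..<n}\<close> is represented by its edge set, a set of two-element
  subsets of \<open>{..<n}\<close>. Isolated vertices play no role for triangles, so the vertex set is not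
  carried along.\<close>

definition all_edges :: "nat \<Rightarrow> nat set set" where
  "all_edges n = {e. e \<subseteq> {..<n} \<and> card e = 2}"

definition binomial_random_graph :: "nat \<Rightarrow> real \<Rightarrow> nat set set pmf" where
  "binomial_random_graph n p =
     map_pmf (\<lambda>present. {e \<in> all_edges n. present e})
       (Pi_pmf (all_edges n) False (\<lambda>_. bernoulli_pmf p))"

definition is_triangle :: "'a set set \<Rightarrow> 'a set \<Rightarrow> bool" where
  "is_triangle E t \<longleftrightarrow> card t = 3 \<and> {e. e \<subseteq> t \<and> card e = 2} \<subseteq> E"

definition K3_tiling :: "'a set set \<Rightarrow> 'a set set \<Rightarrow> bool" where
  "K3_tiling E T \<longleftrightarrow> finite T \<and> (\<forall>t\<in>T. is_triangle E t) \<and> disjoint T"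

datatype colour = Red | Blue

text \<open>A colouring is a total function on vertex sets, of which only the values on the edges matter:
  a tiling is monochromatic in colour \<open>k\<close> iff it is a tiling of the subgraph of edges of colour
  \<open>k\<close>.\<close>

definition forces_mono_K3_tiling :: "'a set set \<Rightarrow> nat \<Rightarrow> bool" where
  "forces_mono_K3_tiling E m \<longleftrightarrow>
     (\<forall>c :: 'a set \<Rightarrow> colour. \<exists>k T. K3_tiling {e \<in> E. c e = k} T \<and> card T = m)"

definition Rt_K3 :: "'a set set \<Rightarrow> nat" where
  "Rt_K3 E = Max {m. forces_mono_K3_tiling E m}"

text \<open>The maximum is over a nonempty set, which is finite for every finite graph.\<close>

lemma forces_mono_K3_tiling_0: "forces_mono_K3_tiling E 0"
  unfolding forces_mono_K3_tiling_def K3_tiling_def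
  by (auto intro!: exI[of _ "{}"])

lemma is_triangle_subset:
  assumes "is_triangle E t"
  shows "t \<subseteq> \<Union>E"
proof
  fix x assume x: "x \<in> t"
  from assms have c: "card t = 3" and s: "{e. e \<subseteq> t \<and> card e = 2} \<subseteq> E"
    by (auto simp: is_triangle_def)
  have "t \<noteq> {x}" using c by auto
  with x obtain y where y: "y \<in> t" "y \<noteq> x" by blast
  then have "{x, y} \<in> E" using s x by auto
  then show "x \<in> \<Union>E" by blast
qed

lemma finite_forces_mono_K3_tiling:
  assumes "finite (\<Union>E)"
  shows "finite {m. forces_mono_K3_tiling E m}"
proof (rule finite_subset)
  show "{m. forces_mono_K3_tiling E m} \<subseteq> {..card (Pow (\<Union>E))}"
  proof clarify
    fix m assume "forces_mono_K3_tiling E m"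
    then obtain k T where T: "K3_tiling {e \<in> E. (\<lambda>_. Red) e = k} T" "card T = m"
      unfolding forces_mono_K3_tiling_def by meson
    have "T \<subseteq> Pow (\<Union>E)"
      using T(1) is_triangle_subset unfolding K3_tiling_def by fastforce
    then show "m \<le> card (Pow (\<Union>E))"
      using T(2) assms by (metis card_mono finite_Pow_iff)
  qed
qed simp

lemma finite_Union_graph:
  assumes "E \<subseteq> all_edges n"
  shows "finite (\<Union>E)"
  using assms by (intro finite_subset[of "\<Union>E" "{..<n}"]) (auto simp: all_edges_def)

end

theory Submission
  imports Defs "HOL-Real_Asymp.Real_Asymp"
begin

text \<open>
  Hypergraph containers replace sparse regularity. Split part of the vertex set into six linear-sized
  classes and colour the edges. Suppose that every red triangle across the classes lies in classes
  0, 1, 2 and every blue one in classes 3, 4, 5. Then the red edges avoid a system of triples, hence lie in a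
  container that spans few of these triples and is determined by \<open>O(n powr (3/2))\<close> of the red edges; the same
  holds for blue. Every colouring of the complete graph on six vertices, one in each class, has a
  forbidden triangle, so the two containers miss at least \<open>\<delta> n\<^sup>2\<close> pairs, and the random graph avoids nearly all of them.
  The probability \<open>exp (- \<delta> p n\<^sup>2)\<close> of this beats the number of fingerprints and of vertex
  partitions as soon as \<open>p \<ge> C n powr (-1/2)\<close>.

  The deterministic part is the Burr--Erdos--Spencer argument: remove intersecting pairs
  of a red and a blue triangle greedily, at most five vertices each. Afterwards no vertex lies in triangles of both
  colours, so by the first part one of the two colours survives on almost no vertices, and the rest is
  tiled greedily in the other colour.
\<close>

section \<open>Containers for triangle systems\<close>

text \<open>A logarithm is the obstacle. A fingerprint has order \<open>n powr (3/2)\<close> edges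
  out of about n^2 pairs, so a plain count allows exp (O(n powr (3/2) * ln n)) of them, more than
  the missing pairs can beat when p is of order \<open>n powr (-1/2)\<close>. But fingerprints
  consist of edges of G, so each choice S also carries the factor p ^ card S; the weighted sum is at
  most exp (O(n powr (3/2)) + c p n^2) with c as small as desired. For this reason present and
  absent edges are tracked together, as one event on two disjoint edge sets.

  The exponent 3/2 is a balance: with degree cap d the two fingerprints of a container step have
  order n d and n^2 / d pairs, and d = sqrt n makes them equal.

  The classes come as 3 + 3 because the deterministic part ends with a set R whose vertices lie in
  no blue triangle and a set B whose vertices lie in no red one. Forcing some monochromatic triangle
  would not suffice there; what has to be excluded is that all red triangles stay inside R and all
  blue ones inside B.\<close>

lemma card_le_fibres:
  fixes k :: real
  assumes "finite X" "finite Y" "\<And>x. x \<in> X \<Longrightarrow> f x \<in> Y"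
    and "\<And>y. y \<in> Y \<Longrightarrow> real (card {x\<in>X. f x = y}) \<le> k"
  shows "real (card X) \<le> k * real (card Y)"
proof -
  have "real (card X) = (\<Sum>y\<in>Y. real (card {x\<in>X. f x = y}))"
    using sum.group[OF assms(1,2), of f "\<lambda>_. 1::real"] assms(3) by force
  also have "\<dots> \<le> (\<Sum>y\<in>Y. k)" by (intro sum_mono assms(4))
  finally show ?thesis by (simp add: mult.commute)
qed

lemma card_ge_fibres:
  fixes k :: real
  assumes "finite X" "finite Y"
    and "\<And>y. y \<in> Y \<Longrightarrow> k \<le> real (card {x\<in>X. f x = y})"
  shows "k * real (card Y) \<le> real (card X)"
proof -
  let ?X = "{x\<in>X. f x \<in> Y}"
  have "k * real (card Y) = (\<Sum>y\<in>Y. k)" by simp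
  also have "\<dots> \<le> (\<Sum>y\<in>Y. real (card {x\<in>?X. f x = y}))"
  proof (intro sum_mono)
    fix y assume y: "y \<in> Y"
    then have "{x\<in>?X. f x = y} = {x\<in>X. f x = y}" by auto
    with assms(3)[OF y] show "k \<le> real (card {x\<in>?X. f x = y})" by simp
  qed
  also have "\<dots> = real (card ?X)"
    using sum.group[of ?X Y f "\<lambda>_. 1::real"] assms(1,2) by force
  also have "\<dots> \<le> real (card X)" using assms(1) by (intro of_nat_mono card_mono) auto
  finally show ?thesis .
qed

text \<open>Fingerprints are taken as maximal sets instead of outputs of an ordered selection: the
  container is read off the fingerprint alone, so no order has to be recoverable.\<close>

lemma ex_maximal_subset:
  assumes "finite I" "P {}"
  obtains S where "S \<subseteq> I" "P S" "\<And>x. x \<in> I \<Longrightarrow> x \<notin> S \<Longrightarrow> \<not> P (insert x S)"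
proof -
  let ?F = "{S. S \<subseteq> I \<and> P S}"
  have "finite ?F" using assms(1) by simp
  moreover have "{} \<in> ?F" using assms(2) by simp
  ultimately obtain S where S: "S \<in> ?F" and m: "\<And>T. T \<in> ?F \<Longrightarrow> S \<subseteq> T \<Longrightarrow> S = T"
    using finite_has_maximal2[of ?F "{}"] by auto
  show ?thesis
  proof (rule that[of S])
    show "\<not> P (insert x S)" if "x \<in> I" "x \<notin> S" for x
      using m[of "insert x S"] S that by auto
  qed (use S in auto)
qed

text \<open>Here Q is a 3-uniform hypergraph whose vertices are ordered pairs, (x,y,z) standing for
  the hyperedge (x,y), (x,z), (y,z). These are the hyperedges induced by A; A is independent when
  there are none.\<close>

definition triangles :: "('a \<times> 'a \<times> 'a) set \<Rightarrow> ('a \<times> 'a) set \<Rightarrow> ('a \<times> 'a \<times> 'a) set" where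
  "triangles Q A = {(x,y,z). (x,y,z) \<in> Q \<and> (x,y) \<in> A \<and> (x,z) \<in> A \<and> (y,z) \<in> A}"

text \<open>The order of quantifiers is the content: \<Phi> is fixed before I, so containers are no
  more numerous than pairs of fingerprints. The container may miss S1 itself, whose pairs are heavy
  and need not have a saturated end; hence the extra union with S1.\<close>

lemma container_step:
  fixes \<delta> :: real and V :: "'a set"
  assumes V: "finite V" "card V \<le> n" and n: "n > 0" and \<delta>: "0 < \<delta>" "\<delta> \<le> 1"
    and A: "A \<subseteq> V \<times> V" and many: "real (card (triangles Q A)) \<ge> \<delta> * real n ^ 3"
  shows "\<exists>\<Phi>. \<forall>I. I \<subseteq> A \<longrightarrow> triangles Q I = {} \<longrightarrow>
    (\<exists>S1 S2. S1 \<subseteq> I \<and> S2 \<subseteq> I \<and>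
       real (card S1) \<le> 32 / \<delta>\<^sup>2 * (real n * sqrt (real n)) \<and>
       real (card S2) \<le> 32 / \<delta>\<^sup>2 * (real n * sqrt (real n)) \<and>
       \<Phi> S1 S2 \<subseteq> A \<and> I \<subseteq> \<Phi> S1 S2 \<union> S1 \<and>
       real (card (\<Phi> S1 S2)) \<le> real (card A) - \<delta>\<^sup>2 / 128 * (real n)\<^sup>2)"
proof -
  define w where "w = sqrt (real n)"
  define N where "N = real n"
  have w: "w > 0" and Nw: "N = w * w" and N: "N > 0" and w1: "w \<ge> 1"
    using n by (auto simp: w_def N_def)
  \<comment> \<open>The cap sqrt n balances the sizes n d and n^2 / d of the two
    fingerprints.\<close>
  define d where "d = nat \<lceil>w\<rceil>"
  have dw: "w \<le> real d" "real d \<le> 2 * w" using w1 unfolding d_def by linarith+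
  define T where "T = triangles Q A"
  have TA: "(x,y,z) \<in> T \<Longrightarrow> (x,y) \<in> A \<and> (x,z) \<in> A \<and> (y,z) \<in> A \<and> x \<in> V \<and> y \<in> V \<and> z \<in> V" for x y z
    using A unfolding T_def triangles_def by auto
  have finA: "finite A" using A V(1) finite_subset by blast
  have finT: "finite T"
    by (rule finite_subset[of _ "V \<times> V \<times> V"]) (use TA V(1) in auto)
  have cV: "real (card V) \<le> N" using V(2) N_def by simp
  have cVV: "real (card (V \<times> V)) \<le> N * N"
    unfolding card_cartesian_product of_nat_mult using cV by (intro mult_mono) auto
  have cA: "real (card A) \<le> N * N"
  proof -
    have "card A \<le> card (V \<times> V)" using A V(1) by (intro card_mono) auto
    then show ?thesis using cVV by linarith
  qed
  define deg where "deg e = card {t\<in>T. (fst t, fst (snd t)) = e}" for e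
  define hi where "hi = {e\<in>A. real (deg e) \<ge> \<delta>/4 * N}"
  define outdeg where "outdeg S x = card {e\<in>S. fst e = x}" for S :: "('a\<times>'a) set" and x
  define indeg where "indeg S y = card {e\<in>S. snd e = y}" for S :: "('a\<times>'a) set" and y
  define \<Gamma> where "\<Gamma> S f = {(y,z) | y z. (fst f,y,z) \<in> T \<and> z = snd f \<and> (fst f, y) \<in> S}"
    for S :: "('a\<times>'a) set" and f
  \<comment> \<open>If S is large, it has at least \<delta>/4 * n * sqrt n pairs, each the base of
    at least \<delta>/4 * n triples; the product is \<gamma> * n^2 * sqrt n.\<close>
  define \<gamma> where "\<gamma> = \<delta>\<^sup>2/16"
  have \<gamma>: "\<gamma> > 0" using \<delta> by (simp add: \<gamma>_def)
  \<comment> \<open>The first fingerprint \<open>S\<close> is a maximal set of heavy edges with degrees at most \<open>d\<close>. If it is small,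
    few vertices are saturated, and a heavy edge outside \<open>S\<close> has a saturated end. If it is large, its
    triangles form an auxiliary graph \<open>\<Gamma>\<close> on the edges, of maximum degree \<open>d\<close> and with many edges,
    in which \<open>I\<close> is independent; the second fingerprint is a maximal set of edges
    that contribute many new neighbours in \<open>\<Gamma>\<close> on average.\<close>
  define \<Phi>1 where "\<Phi>1 S = {(x,y). (x,y)\<in>A \<and> ((x,y) \<notin> hi \<or> outdeg S x \<ge> d \<or> indeg S y \<ge> d)}" for S
  define \<Phi>2 where "\<Phi>2 S S' = {f\<in>A. real (card (\<Gamma> S f - \<Union>(\<Gamma> S ` S'))) < \<gamma>/2*w}" for S S'
  define \<Phi> where "\<Phi> S S' = (if real (card S) < \<delta>/4 * (N * w) then \<Phi>1 S
     else \<Phi>2 S S' - \<Union>(\<Gamma> S ` S'))" for S S'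
  have \<delta>2: "\<delta>\<^sup>2 \<le> \<delta>" using \<delta> by (simp add: power2_eq_square mult_left_le)
  show ?thesis
  proof (intro exI[of _ \<Phi>] allI impI)
    fix I assume I: "I \<subseteq> A" and indep: "triangles Q I = {}"
    have finI: "finite I" using I finA finite_subset by blast
    obtain S where S: "S \<subseteq> I \<inter> hi" and Sd: "\<forall>x. outdeg S x \<le> d \<and> indeg S x \<le> d"
      and Smax: "\<And>e. e \<in> I \<inter> hi \<Longrightarrow> e \<notin> S \<Longrightarrow> \<not> (\<forall>x. outdeg (insert e S) x \<le> d \<and> indeg (insert e S) x \<le> d)"
      by (rule ex_maximal_subset[of "I \<inter> hi" "\<lambda>S. \<forall>x. outdeg S x \<le> d \<and> indeg S x \<le> d"])
         (use finI in \<open>auto simp: outdeg_def indeg_def\<close>)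
    have SV: "S \<subseteq> V \<times> V" using S I A by blast
    have finS: "finite S" using SV V(1) finite_subset by blast
    have cS: "real (card S) \<le> real d * N"
    proof -
      have "real (card S) \<le> real d * real (card V)"
        by (rule card_le_fibres[where f=fst]) (use finS V SV Sd outdeg_def in auto)
      also have "\<dots> \<le> real d * N" using cV by (intro mult_left_mono) auto
      finally show ?thesis .
    qed
    have "real d * N \<le> 2 * w * N" using dw N by (intro mult_right_mono) auto
    moreover have "2 * w * N \<le> 32 / \<delta>\<^sup>2 * (N * w)"
    proof -
      have "2 \<le> 32 / \<delta>\<^sup>2" using \<delta> \<delta>2 by (simp add: field_simps)
      then have "2 * (N * w) \<le> 32 / \<delta>\<^sup>2 * (N * w)" using N w by (intro mult_right_mono) auto
      then show ?thesis by (simp add: mult_ac)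
    qed
    ultimately have cS': "real (card S) \<le> 32 / \<delta>\<^sup>2 * (N * w)" using cS by linarith
    have sat: "outdeg S (fst e) \<ge> d \<or> indeg S (snd e) \<ge> d" if e: "e \<in> I" "e \<in> hi" "e \<notin> S" for e
    proof (rule ccontr)
      assume "\<not> ?thesis"
      then have a: "outdeg S (fst e) < d" "indeg S (snd e) < d" by auto
      have "outdeg (insert e S) x \<le> d" for x
      proof (cases "fst e = x")
        case True
        then have "{e'\<in>insert e S. fst e' = x} = insert e {e'\<in>S. fst e' = x}" by auto
        then have "outdeg (insert e S) x \<le> Suc (outdeg S x)"
          unfolding outdeg_def using finS by (simp add: card_insert_if)
        then show ?thesis using a True by auto
      next
        case False
        then have "{e'\<in>insert e S. fst e' = x} = {e'\<in>S. fst e' = x}" by auto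
        then show ?thesis using Sd by (simp add: outdeg_def)
      qed
      moreover have "indeg (insert e S) x \<le> d" for x
      proof (cases "snd e = x")
        case True
        then have "{e'\<in>insert e S. snd e' = x} = insert e {e'\<in>S. snd e' = x}" by auto
        then have "indeg (insert e S) x \<le> Suc (indeg S x)"
          unfolding indeg_def using finS by (simp add: card_insert_if)
        then show ?thesis using a True by auto
      next
        case False
        then have "{e'\<in>insert e S. snd e' = x} = {e'\<in>S. snd e' = x}" by auto
        then show ?thesis using Sd by (simp add: indeg_def)
      qed
      ultimately show False using Smax[of e] e by blast
    qed
    show "\<exists>S1 S2. S1 \<subseteq> I \<and> S2 \<subseteq> I \<and>
       real (card S1) \<le> 32 / \<delta>\<^sup>2 * (real n * sqrt (real n)) \<and>
       real (card S2) \<le> 32 / \<delta>\<^sup>2 * (real n * sqrt (real n)) \<and>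
       \<Phi> S1 S2 \<subseteq> A \<and> I \<subseteq> \<Phi> S1 S2 \<union> S1 \<and>
       real (card (\<Phi> S1 S2)) \<le> real (card A) - \<delta>\<^sup>2 / 128 * (real n)\<^sup>2"
    proof (cases "real (card S) < \<delta>/4 * (N * w)")
      case True
      have \<Phi>e: "\<Phi> S {} = \<Phi>1 S" using True by (simp add: \<Phi>_def)
      have sub: "\<Phi>1 S \<subseteq> A" by (auto simp: \<Phi>1_def)
      have "I \<subseteq> \<Phi>1 S \<union> S" using sat I by (force simp: \<Phi>1_def)
      define B where "B = A - \<Phi>1 S"
      define X where "X = {x\<in>V. outdeg S x \<ge> d}"
      define Y where "Y = {y\<in>V. indeg S y \<ge> d}"
      have cX: "w * real (card X) \<le> real (card S)"
        by (rule card_ge_fibres[where f=fst]) (use finS V dw in \<open>auto simp: X_def outdeg_def\<close>)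
      have cY: "w * real (card Y) \<le> real (card S)"
        by (rule card_ge_fibres[where f=snd]) (use finS V dw in \<open>auto simp: Y_def indeg_def\<close>)
      have cX': "real (card X) * N \<le> \<delta>/4 * (N * N)"
      proof -
        have "w * real (card X) \<le> w * (\<delta>/4 * N)" using cX True by (simp add: mult_ac)
        then show ?thesis using w N by (simp add: mult_ac)
      qed
      have cY': "real (card Y) * N \<le> \<delta>/4 * (N * N)"
      proof -
        have "w * real (card Y) \<le> w * (\<delta>/4 * N)" using cY True by (simp add: mult_ac)
        then show ?thesis using w N by (simp add: mult_ac)
      qed
      \<comment> \<open>The \<delta> n^3 triples are charged to a removed base pair, a light base
        pair, a saturated first vertex or a saturated second vertex. The last three take at most a
        quarter each, so the removed pairs carry the remaining quarter, with at most n triples per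
        pair.\<close>
      let ?T1 = "{t\<in>T. (fst t, fst (snd t)) \<in> B}"
      let ?T2 = "{t\<in>T. (fst t, fst (snd t)) \<in> A - hi}"
      let ?T3 = "{t\<in>T. fst t \<in> X}"
      let ?T4 = "{t\<in>T. fst (snd t) \<in> Y}"
      have fib: "real (card {t\<in>{t\<in>T. P t}. (fst t, fst (snd t)) = e}) \<le> N" for e and P :: "'a\<times>'a\<times>'a \<Rightarrow> bool"
      proof -
        have "card {t\<in>{t\<in>T. P t}. (fst t, fst (snd t)) = e} \<le> card V"
          by (rule card_inj_on_le[where f="\<lambda>t. snd (snd t)"])
             (use TA V in \<open>force simp: inj_on_def\<close>)+
        then show ?thesis using cV by linarith
      qed
      have c1: "real (card ?T1) \<le> N * real (card B)"
        by (rule card_le_fibres[where f="\<lambda>t. (fst t, fst (snd t))"])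
           (rule fib | use finT finA in \<open>simp add: B_def; fail\<close> | blast)+
      have c2: "real (card ?T2) \<le> \<delta>/4 * N * real (card (A - hi))"
      proof (rule card_le_fibres[where f="\<lambda>t. (fst t, fst (snd t))"])
        fix y assume y: "y \<in> A - hi"
        have "{x \<in> {t \<in> T. (fst t, fst (snd t)) \<in> A - hi}. (fst x, fst (snd x)) = y} = {t\<in>T. (fst t, fst (snd t)) = y}"
          using y by auto
        then show "real (card {x \<in> {t \<in> T. (fst t, fst (snd t)) \<in> A - hi}. (fst x, fst (snd x)) = y}) \<le> \<delta>/4 * N"
          using y unfolding hi_def deg_def by auto
      qed (use finT finA in auto)
      have cAhi: "\<delta>/4 * N * real (card (A - hi)) \<le> \<delta>/4 * N * (N * N)"
      proof (rule mult_left_mono)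
        have "card (A - hi) \<le> card A" using finA by (intro card_mono) auto
        then show "real (card (A - hi)) \<le> N * N" using cA by linarith
      qed (use \<delta> N in auto)
      have fib2: "real (card {t\<in>{t\<in>T. P t}. fst t = x}) \<le> N * N" for x and P :: "'a\<times>'a\<times>'a \<Rightarrow> bool"
      proof -
        have "card {t\<in>{t\<in>T. P t}. fst t = x} \<le> card (V \<times> V)"
          by (rule card_inj_on_le[where f=snd]) (use TA V in \<open>force simp: inj_on_def\<close>)+
        then show ?thesis using cVV by linarith
      qed
      have fib3: "real (card {t\<in>{t\<in>T. P t}. fst (snd t) = x}) \<le> N * N" for x and P :: "'a\<times>'a\<times>'a \<Rightarrow> bool"
      proof -
        have "card {t\<in>{t\<in>T. P t}. fst (snd t) = x} \<le> card (V \<times> V)"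
          by (rule card_inj_on_le[where f="\<lambda>t. (fst t, snd (snd t))"]) (use TA V in \<open>force simp: inj_on_def\<close>)+
        then show ?thesis using cVV by linarith
      qed
      have c3: "real (card ?T3) \<le> N * N * real (card X)"
        by (rule card_le_fibres[where f=fst]) (rule fib2 | use finT V in \<open>simp add: X_def; fail\<close> | blast)+
      have c4: "real (card ?T4) \<le> N * N * real (card Y)"
        by (rule card_le_fibres[where f="\<lambda>t. fst (snd t)"]) (rule fib3 | use finT V in \<open>simp add: Y_def; fail\<close> | blast)+
      have "T \<subseteq> ?T1 \<union> ?T2 \<union> ?T3 \<union> ?T4"
        using TA by (force simp: B_def \<Phi>1_def X_def Y_def)
      then have "card T \<le> card (?T1 \<union> ?T2 \<union> ?T3 \<union> ?T4)"
        using finT by (intro card_mono) auto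
      also have "\<dots> \<le> card ?T1 + card ?T2 + card ?T3 + card ?T4"
        by (meson add_mono card_Un_le order_trans order_refl)
      finally have "real (card T) \<le> real (card ?T1) + real (card ?T2) + real (card ?T3) + real (card ?T4)"
        by linarith
      then have "\<delta> * N ^ 3 \<le> N * real (card B) + \<delta>/4 * N * (N * N) + N * (real (card X) * N) + N * (real (card Y) * N)"
        using many c1 c2 cAhi c3 c4 by (simp add: T_def[symmetric] N_def[symmetric] mult_ac)
      also have "\<dots> \<le> N * real (card B) + \<delta>/4 * N * (N * N) + N * (\<delta>/4 * (N * N)) + N * (\<delta>/4 * (N * N))"
        using cX' cY' N by (intro add_mono mult_left_mono) auto
      finally have "N * (\<delta>/4 * N\<^sup>2) \<le> N * real (card B)"
        by (simp add: power2_eq_square power3_eq_cube field_simps)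
      then have "\<delta>/4 * N\<^sup>2 \<le> real (card B)" using N by simp
      moreover have "\<delta>\<^sup>2/128 * N\<^sup>2 \<le> \<delta>/4 * N\<^sup>2"
        using \<delta>2 \<delta> by (intro mult_right_mono) auto
      moreover have "card B = card A - card (\<Phi>1 S)" "card (\<Phi>1 S) \<le> card A"
        using sub finA finite_subset[OF sub finA] by (auto simp: B_def card_Diff_subset card_mono)
      ultimately have "real (card (\<Phi>1 S)) \<le> real (card A) - \<delta>\<^sup>2/128 * N\<^sup>2"
        by linarith
      then show ?thesis
        using S cS' \<open>I \<subseteq> \<Phi>1 S \<union> S\<close> sub N w \<delta>
        by (intro exI[of _ S] exI[of _ "{}"]) (auto simp: \<Phi>e N_def w_def)
    next
      case False
      then have big: "real (card S) \<ge> \<delta>/4 * (N * w)" by simp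
      define G where "G S' = \<Union>(\<Gamma> S ` S')" for S'
      have GA: "\<Gamma> S f \<subseteq> A" for f using TA by (auto simp: \<Gamma>_def)
      then have GA': "G S' \<subseteq> A" for S' by (auto simp: G_def)
      have finG: "finite (G S')" "finite (\<Gamma> S f)" for S' f
        using finite_subset[OF GA' finA] finite_subset[OF GA finA] by auto
      obtain S' where S': "S' \<subseteq> I" "real (card (G S')) \<ge> \<gamma>/2*w*real (card S')"
        and S'max: "\<And>f. f \<in> I \<Longrightarrow> f \<notin> S' \<Longrightarrow> \<not> real (card (G (insert f S'))) \<ge> \<gamma>/2*w*real (card (insert f S'))"
        by (rule ex_maximal_subset[of I "\<lambda>S'. real (card (G S')) \<ge> \<gamma>/2*w*real (card S')"])
           (use finI in \<open>auto simp: G_def\<close>)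
      have finS': "finite S'" using S' finI finite_subset by blast
      \<comment> \<open>Every member of S' accounts on average for \<gamma>/2 * sqrt n of the at
        most n^2 pairs in \<open>G S'\<close>; solving for the size of S' gives the constant 32 /
        \<delta>^2.\<close>
      have cS2: "real (card S') \<le> 32 / \<delta>\<^sup>2 * (N * w)"
      proof -
        have "card (G S') \<le> card A" using GA' finA by (intro card_mono) auto
        then have "\<gamma>/2*w*real (card S') \<le> N * N" using S'(2) cA by linarith
        then have "w * (\<gamma>/2 * real (card S')) \<le> w * (N * w)" using Nw by (simp add: mult_ac)
        then have "\<gamma>/2 * real (card S') \<le> N * w" using w by simp
        then show ?thesis using \<delta> by (simp add: \<gamma>_def field_simps)
      qed
      \<comment> \<open>The threshold for new neighbours equals the average required of S', so a
        pair of I reaching it could be added to S' against maximality.\<close>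
      have low: "real (card (\<Gamma> S f - G S')) < \<gamma>/2*w" if "f \<in> I" for f
      proof (cases "f \<in> S'")
        case True
        then have "\<Gamma> S f - G S' = {}" by (auto simp: G_def)
        then have "card (\<Gamma> S f - G S') = 0" by (simp only: card.empty)
        then show ?thesis using \<gamma> w by simp
      next
        case nf: False
        have "G (insert f S') = G S' \<union> (\<Gamma> S f - G S')" by (auto simp: G_def)
        moreover have "card (G S' \<union> (\<Gamma> S f - G S')) = card (G S') + card (\<Gamma> S f - G S')"
          by (rule card_Un_disjoint) (use finG in auto)
        ultimately have "card (G (insert f S')) = card (G S') + card (\<Gamma> S f - G S')"
          by (simp only:)
        moreover have "card (insert f S') = Suc (card S')" using finS' nf by simp
        ultimately show ?thesis using S'max[OF that nf] S'(2) by (simp add: algebra_simps)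
      qed
      have IG: "I \<inter> G S' = {}"
      proof -
        have "False" if g: "g \<in> I" "f \<in> S'" "g \<in> \<Gamma> S f" for f g
        proof -
          obtain y z where gy: "g = (y,z)" "(fst f,y,z) \<in> T" "z = snd f" "(fst f,y) \<in> S"
            using g(3) by (auto simp: \<Gamma>_def)
          have "(fst f, y, z) \<in> triangles Q I"
            using gy g S S'(1) unfolding T_def triangles_def by auto
          then show False using indep by simp
        qed
        then show ?thesis by (auto simp: G_def)
      qed
      have \<Phi>e: "\<Phi> S S' = \<Phi>2 S S' - G S'" using False by (simp add: \<Phi>_def G_def)
      have sub: "\<Phi> S S' \<subseteq> A" by (auto simp: \<Phi>e \<Phi>2_def)
      have Isub: "I \<subseteq> \<Phi> S S'" using low IG I by (auto simp: \<Phi>e \<Phi>2_def G_def)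
      define M where "M = {t\<in>T. (fst t, fst (snd t)) \<in> S}"
      have finM: "finite M" using finT by (simp add: M_def)
      have cM: "\<delta>/4 * N * real (card S) \<le> real (card M)"
      proof (rule card_ge_fibres[where f="\<lambda>t. (fst t, fst (snd t))"])
        fix e assume e: "e \<in> S"
        then have "{x\<in>M. (fst x, fst (snd x)) = e} = {t\<in>T. (fst t, fst (snd t)) = e}" by (auto simp: M_def)
        then show "\<delta>/4 * N \<le> real (card {x\<in>M. (fst x, fst (snd x)) = e})"
          using e S by (auto simp: hi_def deg_def)
      qed (use finM finS in auto)
      \<comment> \<open>Each triple based in S is an edge of \<Gamma> from (x,z) to (y,z). Either
        (x,z) was removed or (y,z) was, and the caps on out-degree and in-degree allow d triples per
        pair; or (x,z) survives and has few neighbours outside \<open>G S'\<close>. The last kind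
        uses at most half of \<gamma> * n^2 * sqrt n, so the removed pairs account for the other
        half.\<close>
      define B1 where "B1 = A - \<Phi>2 S S'"
      let ?M1 = "{t\<in>M. (fst t, snd (snd t)) \<in> B1}"
      let ?M2 = "{t\<in>M. snd t \<in> G S'}"
      let ?M3 = "{t\<in>M. (fst t, snd (snd t)) \<in> \<Phi>2 S S' \<and> snd t \<notin> G S'}"
      have c1: "real (card ?M1) \<le> real d * real (card B1)"
      proof (rule card_le_fibres[where f="\<lambda>t. (fst t, snd (snd t))"])
        fix f assume "f \<in> B1"
        have "card {x\<in>?M1. (fst x, snd (snd x)) = f} \<le> outdeg S (fst f)"
          unfolding outdeg_def
          by (rule card_inj_on_le[where f="\<lambda>t. (fst t, fst (snd t))"]) (use finS in \<open>auto simp: inj_on_def M_def\<close>)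
        then show "real (card {x\<in>?M1. (fst x, snd (snd x)) = f}) \<le> real d"
          using Sd by (auto intro: le_trans)
      qed (use finM finA in \<open>auto simp: B1_def\<close>)
      have c2: "real (card ?M2) \<le> real d * real (card (G S'))"
      proof (rule card_le_fibres[where f=snd])
        fix g assume "g \<in> G S'"
        have "card {x\<in>?M2. snd x = g} \<le> indeg S (fst g)"
          unfolding indeg_def
          by (rule card_inj_on_le[where f="\<lambda>t. (fst t, fst (snd t))"]) (use finS in \<open>auto simp: inj_on_def M_def\<close>)
        then show "real (card {x\<in>?M2. snd x = g}) \<le> real d"
          using Sd by (auto intro: le_trans)
      qed (use finM finG in auto)
      have c3: "real (card ?M3) \<le> \<gamma>/2*w * real (card A)"
      proof (rule card_le_fibres[where f="\<lambda>t. (fst t, snd (snd t))"])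
        fix f assume "f \<in> A"
        show "real (card {x\<in>?M3. (fst x, snd (snd x)) = f}) \<le> \<gamma>/2*w"
        proof (cases "f \<in> \<Phi>2 S S'")
          case True
          have "card {x\<in>?M3. (fst x, snd (snd x)) = f} \<le> card (\<Gamma> S f - G S')"
            by (rule card_inj_on_le[where f=snd]) (use finG in \<open>auto simp: inj_on_def M_def \<Gamma>_def\<close>)
          then show ?thesis using True unfolding \<Phi>2_def G_def[symmetric] by simp
        next
          case False
          then have "{x\<in>?M3. (fst x, snd (snd x)) = f} = {}" by auto
          then show ?thesis using \<gamma> w by (metis (no_types, lifting) card.empty of_nat_0 less_eq_real_def half_gt_zero mult_pos_pos)
        qed
      qed (use finM finA TA in \<open>auto simp: \<Phi>2_def\<close>)
      have "M \<subseteq> ?M1 \<union> ?M2 \<union> ?M3" using TA by (force simp: B1_def M_def)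
      then have "card M \<le> card (?M1 \<union> ?M2 \<union> ?M3)" using finM by (intro card_mono) auto
      also have "\<dots> \<le> card ?M1 + card ?M2 + card ?M3"
        by (meson add_mono card_Un_le order_trans order_refl)
      finally have m0: "real (card M) \<le> real (card ?M1) + real (card ?M2) + real (card ?M3)" by linarith
      define B where "B = A - \<Phi> S S'"
      have finB: "finite B" using finA by (simp add: B_def)
      have "card B1 \<le> card B" "card (G S') \<le> card B"
        using finB GA' by (auto intro!: card_mono simp: B_def B1_def \<Phi>e)
      then have b: "real d * real (card B1) \<le> 2*w*real (card B)" "real d * real (card (G S')) \<le> 2*w*real (card B)"
        using dw w by (auto intro!: mult_mono)
      have "\<gamma>/2*w * real (card A) \<le> \<gamma>/2*w * (N*N)" using \<gamma> w cA by (intro mult_left_mono) auto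
      with m0 c1 c2 c3 b have m1: "real (card M) \<le> w * (4 * real (card B) + \<gamma>/2 * N\<^sup>2)"
        by (simp add: algebra_simps power2_eq_square)
      have "\<delta>/4 * N * (\<delta>/4 * (N * w)) \<le> \<delta>/4 * N * real (card S)"
        using big \<delta> N by (intro mult_left_mono) auto
      then have "w * (\<gamma> * N\<^sup>2) \<le> real (card M)" using cM by (simp add: \<gamma>_def power2_eq_square mult_ac)
      with m1 have "w * (\<gamma> * N\<^sup>2) \<le> w * (4 * real (card B) + \<gamma>/2 * N\<^sup>2)" by linarith
      then have "\<gamma> * N\<^sup>2 \<le> 4 * real (card B) + \<gamma>/2 * N\<^sup>2" using w by simp
      then have "\<delta>\<^sup>2/128 * N\<^sup>2 \<le> real (card B)" by (simp add: \<gamma>_def field_simps)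
      moreover have "card B = card A - card (\<Phi> S S')" "card (\<Phi> S S') \<le> card A"
        using sub finA finite_subset[OF sub finA] by (auto simp: B_def card_Diff_subset card_mono)
      ultimately have "real (card (\<Phi> S S')) \<le> real (card A) - \<delta>\<^sup>2/128 * N\<^sup>2"
        by linarith
      then show ?thesis
        using S S' cS' cS2 Isub sub
        by (intro exI[of _ S] exI[of _ S']) (auto simp: N_def w_def)
    qed
  qed
qed
definition few_triangles :: "real \<Rightarrow> nat \<Rightarrow> ('a \<times> 'a \<times> 'a) set \<Rightarrow> ('a \<times> 'a) set \<Rightarrow> bool" where
  "few_triangles \<delta> n Q A \<longleftrightarrow> real (card (triangles Q A)) < \<delta> * real n ^ 3"

text \<open>A step is repeated until the container spans few triples, and otherwise it loses a fixed
  fraction of n^2. That F reads only the first 2 * k entries is part of the induction, since the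
  next step overwrites the entries 2 * k and 2 * k + 1 without changing the earlier
  container.\<close>

lemma container_iterate:
  fixes \<delta> :: real and V :: "'a set"
  assumes V: "finite V" "card V \<le> n" and n: "n > 0" and \<delta>: "0 < \<delta>" "\<delta> \<le> 1"
  shows "\<exists>F. (\<forall>S S'. (\<forall>i<2*k. S i = S' i) \<longrightarrow> F S = F S') \<and>
    (\<forall>I. I \<subseteq> V \<times> V \<longrightarrow> triangles Q I = {} \<longrightarrow>
      (\<exists>S :: nat \<Rightarrow> ('a \<times> 'a) set.
        (\<forall>i. S i \<subseteq> I \<and> real (card (S i)) \<le> 32 / \<delta>\<^sup>2 * (real n * sqrt (real n))) \<and>
        F S \<subseteq> V \<times> V \<and> I \<subseteq> F S \<union> (\<Union>i<2*k. S i) \<and>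
        (few_triangles \<delta> n Q (F S) \<or> real (card (F S)) \<le> (real n)\<^sup>2 - real k * (\<delta>\<^sup>2 / 128 * (real n)\<^sup>2))))"
proof (induction k)
  case 0
  have "real (card V) \<le> real n" using V by simp
  then have "real (card (V \<times> V)) \<le> (real n)\<^sup>2"
    unfolding card_cartesian_product of_nat_mult power2_eq_square by (intro mult_mono) auto
  moreover have "\<forall>I. I \<subseteq> V \<times> V \<longrightarrow> (\<exists>S :: nat \<Rightarrow> ('a \<times> 'a) set.
        (\<forall>i. S i \<subseteq> I \<and> real (card (S i)) \<le> 32 / \<delta>\<^sup>2 * (real n * sqrt (real n))))"
    using \<delta> by (intro allI impI exI[of _ "\<lambda>_. {}"]) auto
  ultimately show ?case
    by (intro exI[of _ "\<lambda>_. V \<times> V"]) auto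
next
  case (Suc k)
  let ?b = "32 / \<delta>\<^sup>2 * (real n * sqrt (real n))"
  let ?P = "\<lambda>A \<Phi>. \<forall>I. I \<subseteq> A \<longrightarrow> triangles Q I = {} \<longrightarrow>
    (\<exists>S1 S2. S1 \<subseteq> I \<and> S2 \<subseteq> I \<and> real (card S1) \<le> ?b \<and> real (card S2) \<le> ?b \<and>
       \<Phi> S1 S2 \<subseteq> A \<and> I \<subseteq> \<Phi> S1 S2 \<union> S1 \<and>
       real (card (\<Phi> S1 S2)) \<le> real (card A) - \<delta>\<^sup>2 / 128 * (real n)\<^sup>2)"
  from Suc.IH obtain F where
    Fcong: "\<forall>S S'. (\<forall>i<2*k. S i = S' i) \<longrightarrow> F S = F S'" and
    F: "\<forall>I. I \<subseteq> V \<times> V \<longrightarrow> triangles Q I = {} \<longrightarrow>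
      (\<exists>S :: nat \<Rightarrow> ('a \<times> 'a) set. (\<forall>i. S i \<subseteq> I \<and> real (card (S i)) \<le> ?b) \<and>
        F S \<subseteq> V \<times> V \<and> I \<subseteq> F S \<union> (\<Union>i<2*k. S i) \<and>
        (few_triangles \<delta> n Q (F S) \<or> real (card (F S)) \<le> (real n)\<^sup>2 - real k * (\<delta>\<^sup>2 / 128 * (real n)\<^sup>2)))"
    by (elim exE conjE) (rule that)
  define \<Phi> where "\<Phi> A = (SOME \<Phi>. ?P A \<Phi>)" for A
  have \<Phi>: "?P A (\<Phi> A)" if "A \<subseteq> V \<times> V" "\<not> few_triangles \<delta> n Q A" for A
  proof -
    have "\<exists>\<Phi>. ?P A \<Phi>"
      by (rule container_step) (use V n \<delta> that in \<open>auto simp: few_triangles_def\<close>)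
    from someI_ex[OF this] show ?thesis unfolding \<Phi>_def .
  qed
  define F' where "F' S = (if few_triangles \<delta> n Q (F S) then F S else \<Phi> (F S) (S (2*k)) (S (2*k+1)))" for S
  show ?case
  proof (intro exI[of _ F'] conjI allI impI)
    fix S S' :: "nat \<Rightarrow> ('a \<times> 'a) set" assume eq: "\<forall>i<2*Suc k. S i = S' i"
    then have "F S = F S'" by (intro Fcong[rule_format]) auto
    with eq show "F' S = F' S'" by (simp add: F'_def)
  next
    fix I assume I: "I \<subseteq> V \<times> V" "triangles Q I = {}"
    from F[rule_format, OF I] obtain S where S: "\<forall>i. S i \<subseteq> I \<and> real (card (S i)) \<le> ?b"
      and FS: "F S \<subseteq> V \<times> V" "I \<subseteq> F S \<union> (\<Union>i<2*k. S i)"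
        "few_triangles \<delta> n Q (F S) \<or> real (card (F S)) \<le> (real n)\<^sup>2 - real k * (\<delta>\<^sup>2 / 128 * (real n)\<^sup>2)"
      by (elim exE conjE) (rule that)
    \<comment> \<open>The step is applied to the part of I inside the container; the rest of I is
      already covered by earlier fingerprints.\<close>
    have indep': "triangles Q (I \<inter> F S) = {}" 
    proof -
      have "triangles Q (I \<inter> F S) \<subseteq> triangles Q I" unfolding triangles_def by blast
      then show ?thesis using I(2) by simp
    qed
    have "\<exists>S1 S2. S1 \<subseteq> I \<and> S2 \<subseteq> I \<and> real (card S1) \<le> ?b \<and> real (card S2) \<le> ?b \<and>
      (few_triangles \<delta> n Q (F S) \<or> (\<Phi> (F S) S1 S2 \<subseteq> F S \<and> I \<inter> F S \<subseteq> \<Phi> (F S) S1 S2 \<union> S1 \<and>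
       real (card (\<Phi> (F S) S1 S2)) \<le> real (card (F S)) - \<delta>\<^sup>2 / 128 * (real n)\<^sup>2))"
    proof (cases "few_triangles \<delta> n Q (F S)")
      case True
      \<comment> \<open>The container no longer changes, so any subset of I of admissible size can
        fill the two new slots.\<close>
      then show ?thesis using S by (intro exI[of _ "S 0"]) auto
    next
      case False
      from \<Phi>[OF FS(1) False, rule_format, OF Int_lower2 indep'] obtain S1 S2 where
        "S1 \<subseteq> I \<inter> F S" "S2 \<subseteq> I \<inter> F S" "real (card S1) \<le> ?b" "real (card S2) \<le> ?b"
        "\<Phi> (F S) S1 S2 \<subseteq> F S" "I \<inter> F S \<subseteq> \<Phi> (F S) S1 S2 \<union> S1"
        "real (card (\<Phi> (F S) S1 S2)) \<le> real (card (F S)) - \<delta>\<^sup>2 / 128 * (real n)\<^sup>2"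
        by (elim exE conjE) (rule that)
      then show ?thesis by (intro exI[of _ S1] exI[of _ S2]) (simp only: le_inf_iff simp_thms)
    qed
    then obtain S1 S2 where S12: "S1 \<subseteq> I" "S2 \<subseteq> I" "real (card S1) \<le> ?b" "real (card S2) \<le> ?b"
      "few_triangles \<delta> n Q (F S) \<or> (\<Phi> (F S) S1 S2 \<subseteq> F S \<and> I \<inter> F S \<subseteq> \<Phi> (F S) S1 S2 \<union> S1 \<and>
       real (card (\<Phi> (F S) S1 S2)) \<le> real (card (F S)) - \<delta>\<^sup>2 / 128 * (real n)\<^sup>2)"
      by (elim exE conjE) (rule that)
    define S' where "S' = S(2*k := S1, 2*k+1 := S2)"
    have F1: "F S' = F S" by (intro Fcong[rule_format]) (auto simp: S'_def)
    have F'e: "F' S' = (if few_triangles \<delta> n Q (F S) then F S else \<Phi> (F S) S1 S2)"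
      using F1 by (simp add: F'_def S'_def)
    have U: "(\<Union>i<2*k. S i) \<union> S1 \<subseteq> (\<Union>i<2*Suc k. S' i)"
    proof
      fix x assume "x \<in> (\<Union>i<2*k. S i) \<union> S1"
      then show "x \<in> (\<Union>i<2*Suc k. S' i)"
      proof
        assume "x \<in> (\<Union>i<2*k. S i)"
        then obtain i where "i < 2*k" "x \<in> S i" by auto
        then show ?thesis by (intro UN_I[of i]) (auto simp: S'_def)
      next
        assume "x \<in> S1"
        then show ?thesis by (intro UN_I[of "2*k"]) (auto simp: S'_def)
      qed
    qed
    show "\<exists>S. (\<forall>i. S i \<subseteq> I \<and> real (card (S i)) \<le> ?b) \<and> F' S \<subseteq> V \<times> V \<and>
      I \<subseteq> F' S \<union> (\<Union>i<2*Suc k. S i) \<and>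
      (few_triangles \<delta> n Q (F' S) \<or> real (card (F' S)) \<le> (real n)\<^sup>2 - real (Suc k) * (\<delta>\<^sup>2 / 128 * (real n)\<^sup>2))"
    proof (intro exI[of _ S'] conjI)
      show "\<forall>i. S' i \<subseteq> I \<and> real (card (S' i)) \<le> ?b" using S S12 by (auto simp: S'_def)
      show "F' S' \<subseteq> V \<times> V" using FS S12 unfolding F'e by auto
      show "I \<subseteq> F' S' \<union> (\<Union>i<2*Suc k. S' i)"
      proof (cases "few_triangles \<delta> n Q (F S)")
        case True
        then show ?thesis using FS(2) U unfolding F'e by (simp only: if_True) blast
      next
        case False
        then have "I \<inter> F S \<subseteq> \<Phi> (F S) S1 S2 \<union> S1" using S12(5) by blast
        then show ?thesis using False FS(2) U unfolding F'e by (simp only: if_False) blast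
      qed
      show "few_triangles \<delta> n Q (F' S') \<or> real (card (F' S')) \<le> (real n)\<^sup>2 - real (Suc k) * (\<delta>\<^sup>2 / 128 * (real n)\<^sup>2)"
      proof (cases "few_triangles \<delta> n Q (F S)")
        case True
        then show ?thesis unfolding F'e by simp
      next
        case False
        then show ?thesis using FS(3) S12(5) unfolding F'e by (auto simp: distrib_right add_divide_distrib)
      qed
    qed
  qed
qed

lemma triangle_containers:
  fixes \<delta> :: real
  assumes \<delta>: "0 < \<delta>" "\<delta> \<le> 1"
  shows "\<exists>k K. K > 0 \<and> (\<forall>n (V :: 'a set) Q. finite V \<longrightarrow> card V \<le> n \<longrightarrow> n > 0 \<longrightarrow>
    (\<exists>F. (\<forall>S S'. (\<forall>i<k. S i = S' i) \<longrightarrow> F S = F S') \<and>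
    (\<forall>I. I \<subseteq> V \<times> V \<longrightarrow> triangles Q I = {} \<longrightarrow>
      (\<exists>S :: nat \<Rightarrow> ('a \<times> 'a) set.
        (\<forall>i. S i \<subseteq> I \<and> real (card (S i)) \<le> K * (real n * sqrt (real n))) \<and>
        I \<subseteq> F S \<union> (\<Union>i<k. S i) \<and> few_triangles \<delta> n Q (F S)))))"
proof -
  \<comment> \<open>After this many losses of \<delta>^2 / 128 * n^2 the size would be negative, so
    the process must have stopped.\<close>
  obtain k where k: "real k > 128 / \<delta>\<^sup>2" using reals_Archimedean2 by blast
  show ?thesis
  proof (intro exI[of _ "2*k"] exI[of _ "32/\<delta>\<^sup>2"] conjI allI impI)
    fix n and V :: "'a set" and Q
    assume V: "finite V" "card V \<le> n" and n: "n > 0"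
    have "128 < real k * \<delta>\<^sup>2" using k \<delta> by (simp add: field_simps)
    then have neg: "(real n)\<^sup>2 - real k * (\<delta>\<^sup>2 / 128 * (real n)\<^sup>2) < 0"
      using n by (simp add: field_simps)
    obtain F where F: "\<forall>S S'. (\<forall>i<2*k. S i = S' i) \<longrightarrow> F S = F S'"
      "\<forall>I. I \<subseteq> V \<times> V \<longrightarrow> triangles Q I = {} \<longrightarrow>
      (\<exists>S :: nat \<Rightarrow> ('a \<times> 'a) set.
        (\<forall>i. S i \<subseteq> I \<and> real (card (S i)) \<le> 32 / \<delta>\<^sup>2 * (real n * sqrt (real n))) \<and>
        F S \<subseteq> V \<times> V \<and> I \<subseteq> F S \<union> (\<Union>i<2*k. S i) \<and>
        (few_triangles \<delta> n Q (F S) \<or> real (card (F S)) \<le> (real n)\<^sup>2 - real k * (\<delta>\<^sup>2 / 128 * (real n)\<^sup>2)))"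
      using container_iterate[OF V n \<delta>, of k Q] by (elim exE conjE) (rule that)
    show "\<exists>F. (\<forall>S S'. (\<forall>i<2*k. S i = S' i) \<longrightarrow> F S = F S') \<and>
    (\<forall>I. I \<subseteq> V \<times> V \<longrightarrow> triangles Q I = {} \<longrightarrow>
      (\<exists>S :: nat \<Rightarrow> ('a \<times> 'a) set.
        (\<forall>i. S i \<subseteq> I \<and> real (card (S i)) \<le> 32/\<delta>\<^sup>2 * (real n * sqrt (real n))) \<and>
        I \<subseteq> F S \<union> (\<Union>i<2*k. S i) \<and> few_triangles \<delta> n Q (F S)))"
    proof (intro exI[of _ F] conjI F(1) allI impI)
      fix I assume I: "I \<subseteq> V \<times> V" "triangles Q I = {}"
      from F(2)[rule_format, OF I] obtain S where S: "\<forall>i. S i \<subseteq> I \<and> real (card (S i)) \<le> 32 / \<delta>\<^sup>2 * (real n * sqrt (real n))"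
        "I \<subseteq> F S \<union> (\<Union>i<2*k. S i)"
        "few_triangles \<delta> n Q (F S) \<or> real (card (F S)) \<le> (real n)\<^sup>2 - real k * (\<delta>\<^sup>2 / 128 * (real n)\<^sup>2)"
        by blast
      have "0 \<le> real (card (F S))" by simp
      then have "few_triangles \<delta> n Q (F S)" using S(3) neg by linarith
      with S(1,2) show "\<exists>S :: nat \<Rightarrow> ('a \<times> 'a) set.
        (\<forall>i. S i \<subseteq> I \<and> real (card (S i)) \<le> 32/\<delta>\<^sup>2 * (real n * sqrt (real n))) \<and>
        I \<subseteq> F S \<union> (\<Union>i<2*k. S i) \<and> few_triangles \<delta> n Q (F S)"
        by blast
    qed
  qed (use \<delta> in auto)
qed

section \<open>Ramsey's theorem across six vertex classes\<close>

text \<open>Choose one valid colour per edge. Two-coloured K6 has at least two monochromatic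
  triangles (Goodman), so a counterexample has exactly the red triangle 012 and the blue triangle
  345. Then each of 3, 4, 5 sends at most one red edge to 012 and each of 0, 1, 2 at most one blue
  edge to 345, which colours only six of the nine cross edges. Both \<open>r i j\<close> and
  \<open>b i j\<close> may hold because the two containers may overlap.\<close>

lemma ramsey_K6_split:
  fixes r b :: "nat \<Rightarrow> nat \<Rightarrow> bool"
  assumes cover: "\<And>i j. i < j \<Longrightarrow> j < 6 \<Longrightarrow> r i j \<or> b i j"
  shows "\<exists>i j k. i < j \<and> j < k \<and> k < 6 \<and>
    (r i j \<and> r i k \<and> r j k \<and> 3 \<le> k \<or> b i j \<and> b i k \<and> b j k \<and> i < 3)"
proof (rule ccontr)
  assume "\<not> ?thesis"
  then have nr: "\<And>i j k. i < j \<Longrightarrow> j < k \<Longrightarrow> k < 6 \<Longrightarrow> 3 \<le> k \<Longrightarrow> \<not> (r i j \<and> r i k \<and> r j k)"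
    and nb: "\<And>i j k. i < j \<Longrightarrow> j < k \<Longrightarrow> k < 6 \<Longrightarrow> i < 3 \<Longrightarrow> \<not> (b i j \<and> b i k \<and> b j k)"
    by blast+
  have c: "r 0 1 \<or> b 0 1" "r 0 2 \<or> b 0 2" "r 0 3 \<or> b 0 3" "r 0 4 \<or> b 0 4" "r 0 5 \<or> b 0 5"
    "r 1 2 \<or> b 1 2" "r 1 3 \<or> b 1 3" "r 1 4 \<or> b 1 4" "r 1 5 \<or> b 1 5" "r 2 3 \<or> b 2 3"
    "r 2 4 \<or> b 2 4" "r 2 5 \<or> b 2 5" "r 3 4 \<or> b 3 4" "r 3 5 \<or> b 3 5" "r 4 5 \<or> b 4 5"
    by (rule cover; simp)+
  have n: "\<not> (r 0 1 \<and> r 0 3 \<and> r 1 3)" "\<not> (r 0 1 \<and> r 0 4 \<and> r 1 4)" "\<not> (r 0 1 \<and> r 0 5 \<and> r 1 5)"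
    "\<not> (r 0 2 \<and> r 0 3 \<and> r 2 3)" "\<not> (r 0 2 \<and> r 0 4 \<and> r 2 4)" "\<not> (r 0 2 \<and> r 0 5 \<and> r 2 5)"
    "\<not> (r 1 2 \<and> r 1 3 \<and> r 2 3)" "\<not> (r 1 2 \<and> r 1 4 \<and> r 2 4)" "\<not> (r 1 2 \<and> r 1 5 \<and> r 2 5)"
    "\<not> (r 0 3 \<and> r 0 4 \<and> r 3 4)" "\<not> (r 0 3 \<and> r 0 5 \<and> r 3 5)" "\<not> (r 0 4 \<and> r 0 5 \<and> r 4 5)"
    "\<not> (r 1 3 \<and> r 1 4 \<and> r 3 4)" "\<not> (r 1 3 \<and> r 1 5 \<and> r 3 5)" "\<not> (r 1 4 \<and> r 1 5 \<and> r 4 5)"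
    "\<not> (r 2 3 \<and> r 2 4 \<and> r 3 4)" "\<not> (r 2 3 \<and> r 2 5 \<and> r 3 5)" "\<not> (r 2 4 \<and> r 2 5 \<and> r 4 5)"
    "\<not> (r 3 4 \<and> r 3 5 \<and> r 4 5)"
    by (rule nr; simp)+
  have m: "\<not> (b 0 1 \<and> b 0 3 \<and> b 1 3)" "\<not> (b 0 1 \<and> b 0 4 \<and> b 1 4)" "\<not> (b 0 1 \<and> b 0 5 \<and> b 1 5)"
    "\<not> (b 0 2 \<and> b 0 3 \<and> b 2 3)" "\<not> (b 0 2 \<and> b 0 4 \<and> b 2 4)" "\<not> (b 0 2 \<and> b 0 5 \<and> b 2 5)"
    "\<not> (b 1 2 \<and> b 1 3 \<and> b 2 3)" "\<not> (b 1 2 \<and> b 1 4 \<and> b 2 4)" "\<not> (b 1 2 \<and> b 1 5 \<and> b 2 5)"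
    "\<not> (b 0 3 \<and> b 0 4 \<and> b 3 4)" "\<not> (b 0 3 \<and> b 0 5 \<and> b 3 5)" "\<not> (b 0 4 \<and> b 0 5 \<and> b 4 5)"
    "\<not> (b 1 3 \<and> b 1 4 \<and> b 3 4)" "\<not> (b 1 3 \<and> b 1 5 \<and> b 3 5)" "\<not> (b 1 4 \<and> b 1 5 \<and> b 4 5)"
    "\<not> (b 2 3 \<and> b 2 4 \<and> b 3 4)" "\<not> (b 2 3 \<and> b 2 5 \<and> b 3 5)" "\<not> (b 2 4 \<and> b 2 5 \<and> b 4 5)"
    "\<not> (b 0 1 \<and> b 0 2 \<and> b 1 2)"
    by (rule nb; simp)+
  from c n m show False by sat
qed

section \<open>Supersaturation by averaging over transversals of the six classes\<close>

lemma card_PiE_vimage_le: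
  assumes I: "finite I" and V: "\<And>i. i \<in> I \<Longrightarrow> finite (V i) \<and> card (V i) \<le> n"
    and X: "finite X" and h: "\<And>t t'. h t = h t' \<Longrightarrow> \<forall>i\<in>J. t i = t' i"
  shows "card {t \<in> PiE I V. h t \<in> X} \<le> card X * n ^ card (I - J)"
proof -
  have fin: "finite (PiE (I - J) V)" using I V by (intro finite_PiE) auto
  have "inj_on (\<lambda>t. (h t, restrict t (I - J))) {t \<in> PiE I V. h t \<in> X}"
  proof (rule inj_onI)
    fix t t' assume t: "t \<in> {t \<in> PiE I V. h t \<in> X}" "t' \<in> {t \<in> PiE I V. h t \<in> X}"
      and eq: "(h t, restrict t (I - J)) = (h t', restrict t' (I - J))"
    show "t = t'"
    proof (rule PiE_ext[of _ I V])
      fix i assume i: "i \<in> I"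
      show "t i = t' i"
      proof (cases "i \<in> J")
        case True
        then show ?thesis using h[of t t'] eq by auto
      next
        case False
        then have "restrict t (I - J) i = t i" "restrict t' (I - J) i = t' i" using i by auto
        then show ?thesis using eq by (metis prod.inject)
      qed
    qed (use t in auto)
  qed
  moreover have "(\<lambda>t. (h t, restrict t (I - J))) ` {t \<in> PiE I V. h t \<in> X} \<subseteq> X \<times> PiE (I - J) V"
    by auto
  ultimately have "card {t \<in> PiE I V. h t \<in> X} \<le> card (X \<times> PiE (I - J) V)"
    using X fin by (intro card_inj_on_le) auto
  also have "\<dots> = card X * (\<Prod>i\<in>I - J. card (V i))"
    using I by (simp add: card_cartesian_product card_PiE)
  also have "(\<Prod>i\<in>I - J. card (V i)) \<le> (\<Prod>i\<in>I - J. n)"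
    using V by (intro prod_mono) auto
  finally show ?thesis by simp
qed

text \<open>Orienting every edge towards the higher class turns it into exactly one ordered pair.
  Vertices of class 6 or more are discarded.\<close>

definition cross_pairs :: "nat \<Rightarrow> (nat \<Rightarrow> nat) \<Rightarrow> (nat \<times> nat) set" where
  "cross_pairs n P = {(x,y). x < n \<and> y < n \<and> P x < P y \<and> P y < 6}"

text \<open>The largest class index is that of z, so \<open>3 \<le> P z\<close> says that the triple
  is not inside classes 0, 1, 2.\<close>

definition red_triples :: "nat \<Rightarrow> (nat \<Rightarrow> nat) \<Rightarrow> (nat \<times> nat \<times> nat) set" where
  "red_triples n P =
     {(x,y,z). x < n \<and> y < n \<and> z < n \<and> P x < P y \<and> P y < P z \<and> P z < 6 \<and> 3 \<le> P z}"

definition blue_triples :: "nat \<Rightarrow> (nat \<Rightarrow> nat) \<Rightarrow> (nat \<times> nat \<times> nat) set" where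
  "blue_triples n P =
     {(x,y,z). x < n \<and> y < n \<and> z < n \<and> P x < P y \<and> P y < P z \<and> P z < 6 \<and> P x < 3}"

text \<open>Each of the at least (\<eta> n)^6 transversals contains an uncovered pair, a red triple
  of A or a blue triple of B. A given pair lies in at most n^4 transversals for each position, a
  given triple in at most n^3. With at most 36 positions for pairs and 216 for triples, the bad
  configurations reach at most 36 + 216 + 216 = 468 times \<delta> n^6, below 600 * \<delta> * n^6 =
  (\<eta> n)^6.\<close>

lemma many_uncovered_pairs:
  fixes \<eta> \<delta> :: real
  assumes \<eta>: "\<eta> > 0" and \<delta>: "\<delta> = \<eta> ^ 6 / 600" and n: "n > 0"
    and parts: "\<And>i. i < 6 \<Longrightarrow> real (card {x. x < n \<and> P x = i}) \<ge> \<eta> * real n"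
    and red: "few_triangles \<delta> n (red_triples n P) A"
    and blue: "few_triangles \<delta> n (blue_triples n P) B"
  shows "real (card (cross_pairs n P - (A \<union> B))) \<ge> \<delta> * (real n)\<^sup>2"
proof (rule ccontr)
  define D where "D = cross_pairs n P - (A \<union> B)"
  assume "\<not> ?thesis"
  then have D: "real (card D) \<le> \<delta> * (real n)\<^sup>2" by (simp add: D_def)
  define V where "V i = {x. x < n \<and> P x = i}" for i
  have V: "finite (V i) \<and> card (V i) \<le> n" for i
    using card_mono[of "{..<n}" "V i"] by (auto simp: V_def)
  define T where "T = PiE {..<6::nat} V"
  define TR where "TR = triangles (red_triples n P) A"
  define TB where "TB = triangles (blue_triples n P) B"
  have fD: "finite D"
    by (rule finite_subset[of _ "{..<n} \<times> {..<n}"]) (auto simp: D_def cross_pairs_def)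
  have fTR: "finite TR"
    by (rule finite_subset[of _ "{..<n} \<times> {..<n} \<times> {..<n}"]) (auto simp: TR_def triangles_def red_triples_def)
  have fTB: "finite TB"
    by (rule finite_subset[of _ "{..<n} \<times> {..<n} \<times> {..<n}"]) (auto simp: TB_def triangles_def blue_triples_def)
  define I2 where "I2 = {(i,j). i < j \<and> j < (6::nat)}"
  define I3 where "I3 = {(i,j,k). i < j \<and> j < k \<and> k < (6::nat)}"
  have I2: "finite I2" "card I2 \<le> 36"
  proof -
    have s: "I2 \<subseteq> {..<6} \<times> {..<6}" by (auto simp: I2_def)
    show "finite I2" using s finite_subset by blast
    show "card I2 \<le> 36" using card_mono[OF _ s] by simp
  qed
  have I3: "finite I3" "card I3 \<le> 216"
  proof -
    have s: "I3 \<subseteq> {..<6} \<times> {..<6} \<times> {..<6}" by (auto simp: I3_def)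
    show "finite I3" using s finite_subset by blast
    show "card I3 \<le> 216" using card_mono[OF _ s] by simp
  qed
  define U2 where "U2 e = {t\<in>T. (t (fst e), t (snd e)) \<in> D}" for e
  define U3 where "U3 X e = {t\<in>T. (t (fst e), t (fst (snd e)), t (snd (snd e))) \<in> X}"
    for X :: "(nat\<times>nat\<times>nat) set" and e :: "nat\<times>nat\<times>nat"
  have U2: "card (U2 e) \<le> card D * n ^ 4" if e: "e \<in> I2" for e
  proof -
    have "card (U2 e) \<le> card D * n ^ card ({..<6::nat} - {fst e, snd e})"
      unfolding U2_def T_def by (rule card_PiE_vimage_le) (use V fD in auto)
    moreover have "card ({..<6::nat} - {fst e, snd e}) = 4"
      using e by (auto simp: I2_def card_Diff_subset)
    ultimately show ?thesis by simp
  qed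
  have U3: "card (U3 X e) \<le> card X * n ^ 3" if e: "e \<in> I3" and X: "finite X" for e X
  proof -
    have "card (U3 X e) \<le> card X * n ^ card ({..<6::nat} - {fst e, fst (snd e), snd (snd e)})"
      unfolding U3_def T_def by (rule card_PiE_vimage_le) (use V X in auto)
    moreover have "card ({..<6::nat} - {fst e, fst (snd e), snd (snd e)}) = 3"
      using e by (auto simp: I3_def card_Diff_subset)
    ultimately show ?thesis by simp
  qed
  have cover: "T \<subseteq> (\<Union>e\<in>I2. U2 e) \<union> (\<Union>e\<in>I3. U3 TR e) \<union> (\<Union>e\<in>I3. U3 TB e)"
  proof
    fix t assume t: "t \<in> T"
    have tV: "t i < n \<and> P (t i) = i" if "i < 6" for i
      using t that by (auto simp: T_def V_def PiE_iff)
    show "t \<in> (\<Union>e\<in>I2. U2 e) \<union> (\<Union>e\<in>I3. U3 TR e) \<union> (\<Union>e\<in>I3. U3 TB e)"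
    proof (cases "\<exists>i j. i < j \<and> j < 6 \<and> (t i, t j) \<in> D")
      case True
      then obtain i j where ij: "i < j" "j < 6" "(t i, t j) \<in> D" by blast
      then have "(i,j) \<in> I2" "t \<in> U2 (i,j)" using t by (auto simp: I2_def U2_def)
      then show ?thesis by blast
    next
      case False
      then have "(t i, t j) \<in> A \<or> (t i, t j) \<in> B" if "i < j" "j < 6" for i j
        using that tV[of i] tV[of j] by (auto simp: D_def cross_pairs_def)
      from ramsey_K6_split[of "\<lambda>i j. (t i, t j) \<in> A" "\<lambda>i j. (t i, t j) \<in> B", OF this]
      obtain i j k where ijk: "i < j" "j < k" "k < 6" and
        or: "(t i, t j) \<in> A \<and> (t i, t k) \<in> A \<and> (t j, t k) \<in> A \<and> 3 \<le> k \<or>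
         (t i, t j) \<in> B \<and> (t i, t k) \<in> B \<and> (t j, t k) \<in> B \<and> i < 3" by blast
      have e: "(i,j,k) \<in> I3" using ijk by (auto simp: I3_def)
      from or have "t \<in> U3 TR (i,j,k) \<or> t \<in> U3 TB (i,j,k)"
        using t ijk tV[of i] tV[of j] tV[of k]
        by (auto simp: U3_def TR_def TB_def triangles_def red_triples_def blue_triples_def)
      then show ?thesis using e by blast
    qed
  qed
  have fT: "finite T" unfolding T_def using V by (intro finite_PiE) auto
  have c2: "card (\<Union>e\<in>I2. U2 e) \<le> 36 * (card D * n ^ 4)"
  proof -
    have "card (\<Union>e\<in>I2. U2 e) \<le> (\<Sum>e\<in>I2. card (U2 e))" using I2 by (intro card_UN_le)
    also have "\<dots> \<le> card I2 * (card D * n ^ 4)" using sum_bounded_above[OF U2] by simp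
    also have "\<dots> \<le> 36 * (card D * n ^ 4)" using I2 by (intro mult_right_mono) auto
    finally show ?thesis .
  qed
  have c3: "card (\<Union>e\<in>I3. U3 X e) \<le> 216 * (card X * n ^ 3)" if X: "finite X" for X
  proof -
    have "card (\<Union>e\<in>I3. U3 X e) \<le> (\<Sum>e\<in>I3. card (U3 X e))" using I3 by (intro card_UN_le)
    also have "\<dots> \<le> card I3 * (card X * n ^ 3)" using sum_bounded_above[OF U3[OF _ X]] by simp
    also have "\<dots> \<le> 216 * (card X * n ^ 3)" using I3 by (intro mult_right_mono) auto
    finally show ?thesis .
  qed
  have "card T \<le> card ((\<Union>e\<in>I2. U2 e) \<union> (\<Union>e\<in>I3. U3 TR e) \<union> (\<Union>e\<in>I3. U3 TB e))"
    using cover fT I2 I3 by (intro card_mono) (auto simp: U2_def U3_def)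
  also have "\<dots> \<le> card (\<Union>e\<in>I2. U2 e) + card (\<Union>e\<in>I3. U3 TR e) + card (\<Union>e\<in>I3. U3 TB e)"
    by (meson add_mono card_Un_le order_trans order_refl)
  also have "\<dots> \<le> 36 * (card D * n ^ 4) + 216 * (card TR * n ^ 3) + 216 * (card TB * n ^ 3)"
    using c2 c3[OF fTR] c3[OF fTB] by linarith
  finally have "real (card T) \<le> real (36 * (card D * n ^ 4) + 216 * (card TR * n ^ 3) + 216 * (card TB * n ^ 3))"
    by (rule of_nat_mono)
  then have "real (card T) \<le> 36 * (real (card D) * real n ^ 4) + 216 * (real (card TR) * real n ^ 3) + 216 * (real (card TB) * real n ^ 3)"
    by simp
  also have "\<dots> \<le> 36 * (\<delta> * (real n)\<^sup>2 * real n ^ 4) + 216 * (\<delta> * real n ^ 3 * real n ^ 3) + 216 * (\<delta> * real n ^ 3 * real n ^ 3)"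
    using D red blue by (intro add_mono mult_left_mono mult_right_mono) (auto simp: TR_def TB_def few_triangles_def)
  also have "\<dots> = 468 * \<delta> * real n ^ 6" by (simp add: eval_nat_numeral)
  finally have up: "real (card T) \<le> 468 * \<delta> * real n ^ 6" .
  have "(\<eta> * real n) ^ 6 = (\<Prod>i<6::nat. \<eta> * real n)" by simp
  also have "\<dots> \<le> (\<Prod>i<6::nat. real (card (V i)))"
    using parts \<eta> by (intro prod_mono) (auto simp: V_def)
  also have "\<dots> = real (card T)" by (simp add: T_def card_PiE)
  finally have "\<eta> ^ 6 * real n ^ 6 \<le> 468 * \<delta> * real n ^ 6"
    using up unfolding power_mult_distrib by linarith
  moreover have "\<eta> ^ 6 = 600 * \<delta>" using \<delta> by simp
  ultimately have "600 * \<delta> * real n ^ 6 \<le> 468 * \<delta> * real n ^ 6" by simp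
  moreover have "\<delta> * real n ^ 6 > 0" unfolding \<delta> using \<eta> n by simp
  ultimately show False by simp
qed

text \<open>Its failure yields a colouring in which the red cross pairs are independent for
  \<open>red_triples\<close> and the blue ones for \<open>blue_triples\<close>.\<close>

definition forces_on_parts :: "nat \<Rightarrow> (nat \<Rightarrow> nat) \<Rightarrow> nat set set \<Rightarrow> bool" where
  "forces_on_parts n P G \<longleftrightarrow> (\<forall>c :: nat set \<Rightarrow> colour. \<exists>x y z.
     x < n \<and> y < n \<and> z < n \<and> P x < P y \<and> P y < P z \<and> P z < 6 \<and>
     {x,y} \<in> G \<and> {x,z} \<in> G \<and> {y,z} \<in> G \<and>
     (c {x,y} = Red \<and> c {x,z} = Red \<and> c {y,z} = Red \<and> 3 \<le> P z \<or>
      c {x,y} = Blue \<and> c {x,z} = Blue \<and> c {y,z} = Blue \<and> P x < 3))"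

section \<open>The random graph\<close>

lemma finite_all_edges: "finite (all_edges n)"
  by (rule finite_subset[of _ "Pow {..<n}"]) (auto simp: all_edges_def)

lemma card_all_edges_le: "real (card (all_edges n)) \<le> (real n)\<^sup>2"
proof -
  have "all_edges n \<subseteq> (\<lambda>(x,y). {x,y}) ` ({..<n} \<times> {..<n})"
    by (auto simp: all_edges_def card_2_iff)
  then have "card (all_edges n) \<le> card ({..<n} \<times> {..<n})"
    using surj_card_le[of "{..<n} \<times> {..<n}" "all_edges n"] by auto
  then show ?thesis by (simp add: power2_eq_square flip: of_nat_mult)
qed

lemma prob_contains_avoids:
  assumes S: "S \<subseteq> all_edges n" and D: "D \<subseteq> all_edges n" "S \<inter> D = {}" and p: "0 \<le> p" "p \<le> 1"
  shows "measure_pmf.prob (binomial_random_graph n p) {G. S \<subseteq> G \<and> D \<inter> G = {}} =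
    p ^ card S * (1 - p) ^ card D"
proof -
  let ?E = "all_edges n"
  let ?M = "Pi_pmf ?E False (\<lambda>_. bernoulli_pmf p)"
  define B where "B e = (if e \<in> S then {True} else if e \<in> D then {False} else UNIV)" for e
  have "(\<lambda>present. {e \<in> ?E. present e}) -` {G. S \<subseteq> G \<and> D \<inter> G = {}} = Pi ?E B"
  proof (intro set_eqI iffI)
    fix f assume f: "f \<in> Pi ?E B"
    have "f e" if "e \<in> S" for e
    proof -
      have "f e \<in> B e" using f that S by auto
      then show ?thesis using that by (simp add: B_def)
    qed
    moreover have "\<not> f e" if "e \<in> D" for e
    proof -
      have "f e \<in> B e" "e \<notin> S" using f that D by auto
      then show ?thesis using that by (simp add: B_def)
    qed
    ultimately show "f \<in> (\<lambda>present. {e \<in> ?E. present e}) -` {G. S \<subseteq> G \<and> D \<inter> G = {}}"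
      using S by auto
  qed (auto simp: B_def)
  then have "measure_pmf.prob (binomial_random_graph n p) {G. S \<subseteq> G \<and> D \<inter> G = {}} =
      (\<Prod>e\<in>?E. measure_pmf.prob (bernoulli_pmf p) (B e))"
    unfolding binomial_random_graph_def measure_map_pmf
    by (simp only: measure_Pi_pmf_Pi[OF finite_all_edges])
  also have "\<dots> = (\<Prod>e\<in>?E. (if e \<in> S then p else 1) * (if e \<in> D then 1 - p else 1))"
  proof (intro prod.cong refl)
    fix e
    show "measure_pmf.prob (bernoulli_pmf p) (B e) = (if e \<in> S then p else 1) * (if e \<in> D then 1 - p else 1)"
      using D p by (auto simp: B_def measure_pmf_single)
  qed
  also have "\<dots> = (\<Prod>e\<in>?E. if e \<in> S then p else 1) * (\<Prod>e\<in>?E. if e \<in> D then 1 - p else 1)"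
    by (rule prod.distrib)
  also have "(\<Prod>e\<in>?E. if e \<in> S then p else 1) = p ^ card S"
    using S finite_all_edges by (simp add: prod.If_cases Int_absorb1 Int_absorb2)
  also have "(\<Prod>e\<in>?E. if e \<in> D then 1 - p else 1) = (1 - p) ^ card D"
    using D finite_all_edges by (simp add: prod.If_cases Int_absorb1 Int_absorb2)
  finally show ?thesis .
qed

text \<open>The weight is a product over edges: an edge contributes 1 for the empty label and q for
  each other one, at most 1 + 2 ^ k * q in total. This replaces counting fingerprints by binomial
  coefficients and so avoids the logarithm.\<close>

lemma sum_labellings_le:
  fixes q :: real
  assumes E: "finite E" and q: "q \<ge> 0"
  shows "(\<Sum>X\<in>PiE E (\<lambda>_. Pow {..<k}). q ^ card {e\<in>E. X e \<noteq> {}}) \<le> exp (2 ^ k * q * real (card E))"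
proof -
  let ?L = "Pow {..<k::nat}"
  have "(\<Sum>X\<in>PiE E (\<lambda>_. ?L). q ^ card {e\<in>E. X e \<noteq> {}}) =
      (\<Sum>X\<in>PiE E (\<lambda>_. ?L). \<Prod>e\<in>E. if X e = {} then 1 else q)"
  proof (intro sum.cong refl)
    fix X :: "'a \<Rightarrow> nat set"
    have "(\<Prod>e\<in>E. if X e = {} then 1 else q) = (\<Prod>e\<in>E. if X e \<noteq> {} then q else 1)"
      by (intro prod.cong) auto
    also have "\<dots> = q ^ card {e\<in>E. X e \<noteq> {}}"
      using E by (simp add: prod.If_cases Int_def)
    finally show "q ^ card {e\<in>E. X e \<noteq> {}} = (\<Prod>e\<in>E. if X e = {} then 1 else q)" ..
  qed
  also have "\<dots> = (\<Prod>e\<in>E. \<Sum>Y\<in>?L. if Y = {} then 1 else q)"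
    using E by (subst prod_sum_PiE) auto
  also have "\<dots> = (\<Sum>Y\<in>?L. if Y = {} then 1 else q) ^ card E" by simp
  also have "(\<Sum>Y\<in>?L. if Y = {} then 1 else q) \<le> exp (2 ^ k * q)"
  proof -
    have "(\<Sum>Y\<in>?L. if Y = {} then 1 else q) = 1 + (\<Sum>Y\<in>?L - {{}}. if Y = {} then 1 else q)"
      by (subst sum.remove[of _ "{}"]) auto
    also have "(\<Sum>Y\<in>?L - {{}}. if Y = {} then 1 else q) = (\<Sum>Y\<in>?L - {{}}. q)"
      by (intro sum.cong) auto
    also have "(\<Sum>Y\<in>?L - {{}}. q) \<le> (\<Sum>Y\<in>?L. q)" using q by (intro sum_mono2) auto
    also have "(\<Sum>Y\<in>?L. q) = 2 ^ k * q" by (simp add: card_Pow)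
    finally have "(\<Sum>Y\<in>?L. if Y = {} then 1 else q) \<le> 1 + 2 ^ k * q" by simp
    also have "\<dots> \<le> exp (2 ^ k * q)" by (rule exp_ge_add_one_self)
    finally show ?thesis .
  qed
  then have "(\<Sum>Y\<in>?L. if Y = {} then 1 else q) ^ card E \<le> exp (2 ^ k * q) ^ card E"
    using q by (intro power_mono sum_nonneg) auto
  also have "\<dots> = exp (2 ^ k * q * real (card E))" by (simp add: exp_of_nat_mult[symmetric] mult.commute)
  finally show ?thesis by simp
qed

section \<open>From bad colourings to events about present and absent edges\<close>

lemma edge_eq_cross_pairs:
  assumes "(x,y) \<in> cross_pairs n P" "(x',y') \<in> cross_pairs n P" "{x,y} = {x',y'}"
  shows "x = x' \<and> y = y'"
  using assms by (auto simp: cross_pairs_def doubleton_eq_iff)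

lemma cross_pair_edge:
  assumes "e \<in> cross_pairs n P"
  shows "{fst e, snd e} \<in> all_edges n"
proof -
  have "fst e \<noteq> snd e" using assms by (auto simp: cross_pairs_def)
  then show ?thesis using assms by (auto simp: cross_pairs_def all_edges_def)
qed

text \<open>This removes the colouring from the picture: what remains is a labelling X, a set of
  edges that G contains and a large disjoint set that G avoids, both determined by X. Such an event
  has an explicit probability.\<close>

lemma containers_of_non_forcing:
  assumes FR: "\<And>S S'. (\<forall>i<k. S i = S' i) \<Longrightarrow> FR S = FR S'"
    and FB: "\<And>S S'. (\<forall>i<k. S i = S' i) \<Longrightarrow> FB S = FB S'"
    and CR: "\<And>I. I \<subseteq> {..<n} \<times> {..<n} \<Longrightarrow> triangles (red_triples n P) I = {} \<Longrightarrow>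
      (\<exists>S. (\<forall>i. S i \<subseteq> I \<and> real (card (S i)) \<le> s) \<and>
        I \<subseteq> FR S \<union> (\<Union>i<k. S i) \<and> few_triangles \<delta> n (red_triples n P) (FR S))"
    and CB: "\<And>I. I \<subseteq> {..<n} \<times> {..<n} \<Longrightarrow> triangles (blue_triples n P) I = {} \<Longrightarrow>
      (\<exists>S. (\<forall>i. S i \<subseteq> I \<and> real (card (S i)) \<le> s) \<and>
        I \<subseteq> FB S \<union> (\<Union>i<k. S i) \<and> few_triangles \<delta> n (blue_triples n P) (FB S))"
    and many: "\<And>A B. few_triangles \<delta> n (red_triples n P) A \<Longrightarrow> few_triangles \<delta> n (blue_triples n P) B \<Longrightarrow>
      real (card (cross_pairs n P - (A \<union> B))) \<ge> d"
    and G: "\<not> forces_on_parts n P G"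
    \<comment> \<open>A labelling \<open>X\<close> of the edges encodes both lists of fingerprints: label \<open>i < k\<close> for the red ones,
      \<open>k + i\<close> for the blue ones.\<close>
  defines "SR \<equiv> \<lambda>X i. {e \<in> cross_pairs n P. i \<in> X {fst e, snd e}}"
    and "SB \<equiv> \<lambda>X i. {e \<in> cross_pairs n P. k + i \<in> X {fst e, snd e}}"
    and "supp \<equiv> \<lambda>X. {e \<in> all_edges n. X e \<noteq> {}}"
  shows "\<exists>X\<in>PiE (all_edges n) (\<lambda>_. Pow {..<2*k}).
    real (card (supp X)) \<le> 2 * real k * s \<and> supp X \<subseteq> G \<and>
    real (card ((\<lambda>e. {fst e, snd e}) ` (cross_pairs n P - (FR (SR X) \<union> FB (SB X))) - supp X)) \<ge> d - 2 * real k * s \<and>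
    ((\<lambda>e. {fst e, snd e}) ` (cross_pairs n P - (FR (SR X) \<union> FB (SB X))) - supp X) \<inter> G = {}"
proof -
  let ?u = "\<lambda>e. {fst e, snd e} :: nat set"
  let ?C = "cross_pairs n P"
  have finC: "finite ?C"
    by (rule finite_subset[of _ "{..<n} \<times> {..<n}"]) (auto simp: cross_pairs_def)
  have injC: "inj_on ?u ?C"
    by (intro inj_onI) (metis edge_eq_cross_pairs prod.collapse)
  have uE: "?u e \<in> all_edges n" if "e \<in> ?C" for e
    using that by (rule cross_pair_edge)
  obtain c :: "nat set \<Rightarrow> colour" where c: "\<And>x y z.
     x < n \<Longrightarrow> y < n \<Longrightarrow> z < n \<Longrightarrow> P x < P y \<Longrightarrow> P y < P z \<Longrightarrow> P z < 6 \<Longrightarrow>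
     {x,y} \<in> G \<Longrightarrow> {x,z} \<in> G \<Longrightarrow> {y,z} \<in> G \<Longrightarrow>
     \<not> (c {x,y} = Red \<and> c {x,z} = Red \<and> c {y,z} = Red \<and> 3 \<le> P z \<or>
      c {x,y} = Blue \<and> c {x,z} = Blue \<and> c {y,z} = Blue \<and> P x < 3)"
    using G unfolding forces_on_parts_def by blast
  define I where "I col = {e \<in> ?C. ?u e \<in> G \<and> c (?u e) = col}" for col
  have IV: "I col \<subseteq> {..<n} \<times> {..<n}" for col by (auto simp: I_def cross_pairs_def)
  have tR: "triangles (red_triples n P) (I Red) = {}"
  proof -
    have False if "(x,y,z) \<in> triangles (red_triples n P) (I Red)" for x y z
      using that c[of x y z] by (auto simp: triangles_def red_triples_def I_def)
    then show ?thesis by auto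
  qed
  have tB: "triangles (blue_triples n P) (I Blue) = {}"
  proof -
    have False if "(x,y,z) \<in> triangles (blue_triples n P) (I Blue)" for x y z
      using that c[of x y z] by (auto simp: triangles_def blue_triples_def I_def)
    then show ?thesis by auto
  qed
  from CR[OF IV tR] obtain S where S: "\<forall>i. S i \<subseteq> I Red \<and> real (card (S i)) \<le> s"
    "I Red \<subseteq> FR S \<union> (\<Union>i<k. S i)" "few_triangles \<delta> n (red_triples n P) (FR S)" by (elim exE conjE) (rule that)
  from CB[OF IV tB] obtain T where T: "\<forall>i. T i \<subseteq> I Blue \<and> real (card (T i)) \<le> s"
    "I Blue \<subseteq> FB T \<union> (\<Union>i<k. T i)" "few_triangles \<delta> n (blue_triples n P) (FB T)" by (elim exE conjE) (rule that)
  define X where "X = restrict (\<lambda>e. {i. i < k \<and> e \<in> ?u ` S i} \<union> {k + i | i. i < k \<and> e \<in> ?u ` T i}) (all_edges n)"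
  have SC: "S i \<subseteq> ?C" "T i \<subseteq> ?C" for i using S(1) T(1) by (auto simp: I_def)
  have inS: "?u e \<in> ?u ` S i \<longleftrightarrow> e \<in> S i" "?u e \<in> ?u ` T i \<longleftrightarrow> e \<in> T i" if "e \<in> ?C" for e i
    using inj_on_image_mem_iff[OF injC that SC(1)] inj_on_image_mem_iff[OF injC that SC(2)] by simp_all
  have X1: "i \<in> X (?u e) \<longleftrightarrow> e \<in> S i" "k + i \<in> X (?u e) \<longleftrightarrow> e \<in> T i" if "e \<in> ?C" "i < k" for e i
    using inS[OF that(1)] that(2) uE[OF that(1)] by (auto simp: X_def)
  have "SR X i = S i" "SB X i = T i" if "i < k" for i
    using X1[OF _ that] SC[of i] unfolding SR_def SB_def by blast+
  \<comment> \<open>For indices from k on, \<open>SR X\<close> also picks up labels of blue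
    fingerprints; FR reads only the indices below k.\<close>
  then have SRX: "FR (SR X) = FR S" and SBX: "FB (SB X) = FB T"
    by (intro FR FB; simp)+
  have suppX: "supp X = (\<Union>i<k. ?u ` S i) \<union> (\<Union>i<k. ?u ` T i)" (is "_ = ?U")
  proof -
    have ne: "{i. i < k \<and> e \<in> A i} \<union> {k + i | i. i < k \<and> e \<in> B i} \<noteq> {} \<longleftrightarrow>
        e \<in> (\<Union>i<k. A i) \<union> (\<Union>i<k. B i)" for e and A B :: "nat \<Rightarrow> nat set set"
      by auto
    have "X e = {i. i < k \<and> e \<in> ?u ` S i} \<union> {k + i | i. i < k \<and> e \<in> ?u ` T i}"
      if "e \<in> all_edges n" for e using that by (simp add: X_def)
    then have XU: "X e \<noteq> {} \<longleftrightarrow> e \<in> ?U" if "e \<in> all_edges n" for e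
      by (simp only: that ne)
    have "?u ` S i \<subseteq> all_edges n" "?u ` T i \<subseteq> all_edges n" for i
      using SC[of i] uE by (auto simp only: image_subset_iff)
    then have UE: "?U \<subseteq> all_edges n" by (intro Un_least UN_least)
    have "{e \<in> all_edges n. X e \<noteq> {}} = U"
      if "U \<subseteq> all_edges n" "\<And>e. e \<in> all_edges n \<Longrightarrow> X e \<noteq> {} \<longleftrightarrow> e \<in> U" for U
      using that by auto
    from this[OF UE XU] show ?thesis unfolding supp_def .
  qed
  have cs: "real (card (supp X)) \<le> 2 * real k * s"
  proof -
    have i: "real (card (?u ` S i)) \<le> s" "real (card (?u ` T i)) \<le> s" for i
    proof -
      have "card (?u ` S i) \<le> card (S i)" "card (?u ` T i) \<le> card (T i)"
        using finite_subset[OF SC(1) finC] finite_subset[OF SC(2) finC] by (auto intro: card_image_le)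
      then have "real (card (?u ` S i)) \<le> real (card (S i))" "real (card (?u ` T i)) \<le> real (card (T i))"
        by auto
      then show "real (card (?u ` S i)) \<le> s" "real (card (?u ` T i)) \<le> s"
        using S(1)[rule_format, of i] T(1)[rule_format, of i] by linarith+
    qed
    have "card (supp X) \<le> card (\<Union>i<k. ?u ` S i) + card (\<Union>i<k. ?u ` T i)"
      unfolding suppX by (rule card_Un_le)
    also have "\<dots> \<le> (\<Sum>i<k. card (?u ` S i)) + (\<Sum>i<k. card (?u ` T i))"
      by (intro add_mono card_UN_le) auto
    finally have "real (card (supp X)) \<le> real ((\<Sum>i<k. card (?u ` S i)) + (\<Sum>i<k. card (?u ` T i)))"
      by (rule of_nat_mono)
    also have "\<dots> = (\<Sum>i<k. real (card (?u ` S i))) + (\<Sum>i<k. real (card (?u ` T i)))" by simp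
    also have "\<dots> \<le> (\<Sum>i<k. s) + (\<Sum>i<k. s)" using i by (intro add_mono sum_mono) auto
    finally show ?thesis by (simp add: mult_ac)
  qed
  have sG: "supp X \<subseteq> G"
  proof -
    have "?u ` S i \<subseteq> G" "?u ` T i \<subseteq> G" for i
      using S(1)[rule_format, of i] T(1)[rule_format, of i] by (auto simp: I_def)
    then show ?thesis unfolding suppX by (intro Un_least UN_least)
  qed
  \<comment> \<open>A fingerprint edge can lie outside both containers and still be in G, so the
    support is taken out of the avoided set, at a cost of at most 2 * k * s.\<close>
  let ?W = "?C - (FR (SR X) \<union> FB (SB X))"
  have "card (?u ` ?W) = card ?W" by (rule card_image[OF inj_on_subset[OF injC]]) auto
  then have "d \<le> real (card (?u ` ?W))" using many[OF S(3) T(3)] SRX SBX by simp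
  moreover have "card (?u ` ?W) \<le> card (?u ` ?W - supp X) + card (supp X)"
    using diff_card_le_card_Diff[of "supp X" "?u ` ?W"] finite_all_edges[of n] by (simp add: supp_def)
  then have "real (card (?u ` ?W)) \<le> real (card (?u ` ?W - supp X)) + real (card (supp X))" by linarith
  ultimately have cD: "real (card (?u ` ?W - supp X)) \<ge> d - 2 * real k * s" using cs by linarith
  \<comment> \<open>An edge of G across the classes has a colour, hence lies in the container or in
    a fingerprint of that colour.\<close>
  have "(?u ` ?W - supp X) \<inter> G = {}"
  proof -
    have False if e: "e \<in> ?W" "?u e \<notin> supp X" "?u e \<in> G" for e
    proof (cases "c (?u e)")
      case Red
      then have "e \<in> I Red" using e by (simp add: I_def)
      moreover have "e \<notin> FR S" using e(1) SRX by simp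
      ultimately obtain i where "i < k" "e \<in> S i" using S(2) by blast
      then have "?u e \<in> supp X" unfolding suppX by blast
      then show False using e(2) by simp
    next
      case Blue
      then have "e \<in> I Blue" using e by (simp add: I_def)
      moreover have "e \<notin> FB T" using e(1) SBX by simp
      ultimately obtain i where "i < k" "e \<in> T i" using T(2) by blast
      then have "?u e \<in> supp X" unfolding suppX by blast
      then show False using e(2) by simp
    qed
    then show ?thesis by blast
  qed
  moreover have "X \<in> PiE (all_edges n) (\<lambda>_. Pow {..<2*k})" by (auto simp: X_def PiE_iff)
  ultimately show ?thesis using cs sG cD by (intro bexI[of _ X] conjI)
qed

text \<open>The threshold for n is uniform in P and p, because p varies with n and a union over all
  P follows.\<close>

lemma prob_not_forces_on_parts:
  fixes \<eta> :: real
  assumes \<eta>: "0 < \<eta>" "\<eta> \<le> 1"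
  shows "\<exists>\<delta> L. \<delta> > 0 \<and> L > 0 \<and> (\<forall>\<^sub>F n in sequentially. \<forall>P p.
    (\<forall>i<6. \<eta> * real n \<le> real (card {x. x < n \<and> P x = i})) \<longrightarrow> 0 \<le> p \<longrightarrow> p \<le> 1 \<longrightarrow>
    measure_pmf.prob (binomial_random_graph n p) {G. \<not> forces_on_parts n P G}
      \<le> exp (L * (real n * sqrt (real n)) - \<delta> * p * (real n)\<^sup>2))"
proof -
  define \<delta> where "\<delta> = \<eta> ^ 6 / 600"
  have \<delta>: "0 < \<delta>" "\<delta> \<le> 1" using \<eta> power_le_one[of \<eta> 6] by (auto simp: \<delta>_def)
  obtain k K where K: "K > 0" and cont: "\<forall>n (V :: nat set) Q. finite V \<longrightarrow> card V \<le> n \<longrightarrow> n > 0 \<longrightarrow>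
    (\<exists>F. (\<forall>S S'. (\<forall>i<k. S i = S' i) \<longrightarrow> F S = F S') \<and>
    (\<forall>I. I \<subseteq> V \<times> V \<longrightarrow> triangles Q I = {} \<longrightarrow>
      (\<exists>S :: nat \<Rightarrow> (nat \<times> nat) set.
        (\<forall>i. S i \<subseteq> I \<and> real (card (S i)) \<le> K * (real n * sqrt (real n))) \<and>
        I \<subseteq> F S \<union> (\<Union>i<k. S i) \<and> few_triangles \<delta> n Q (F S))))"
    using triangle_containers[where 'a=nat, OF \<delta>] by (elim exE conjE) (rule that)
  \<comment> \<open>Makes the sum over labellings at most exp (4 ^ k * p * y * n^2) = exp
    (\<delta>/4 * p * n^2), half of the exponent \<delta>/2 * p * n^2 gained from the avoided
    edges.\<close>
  define y where "y = \<delta> / (4 * 4 ^ k)"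
  have y: "0 < y" "y \<le> 1"
  proof -
    show "0 < y" using \<delta> by (simp add: y_def)
    have "1 * 1 \<le> (4::real) * 4 ^ k" by (intro mult_mono) auto
    then have "\<delta> \<le> 4 * 4 ^ k" using \<delta> by linarith
    then show "y \<le> 1" by (simp add: y_def)
  qed
  \<comment> \<open>The factor (1/y) powr (2 * k * s) with s = K * n * sqrt n has this exponent,
    apart from the 1 that keeps L positive.\<close>
  define L where "L = 2 * real k * K * ln (1 / y) + 1"
  have lny: "ln (1/y) \<ge> 0" using y by simp
  have L: "L > 0" using lny K by (simp add: L_def add_nonneg_pos)
  \<comment> \<open>Fingerprints have o(n^2) edges, so deleting them leaves at least half of the
    uncovered pairs.\<close>
  have "eventually (\<lambda>n. 2 * real k * (K * (real n * sqrt (real n))) \<le> \<delta>/2 * (real n)\<^sup>2) sequentially"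
    using \<delta> K by real_asymp
  moreover have "eventually (\<lambda>n::nat. n > 0) sequentially" by (rule eventually_gt_at_top)
  ultimately have "\<forall>\<^sub>F n in sequentially. \<forall>P p.
    (\<forall>i<6. \<eta> * real n \<le> real (card {x. x < n \<and> P x = i})) \<longrightarrow> 0 \<le> p \<longrightarrow> p \<le> 1 \<longrightarrow>
    measure_pmf.prob (binomial_random_graph n p) {G. \<not> forces_on_parts n P G}
      \<le> exp (L * (real n * sqrt (real n)) - \<delta>/4 * p * (real n)\<^sup>2)"
  proof eventually_elim
    case (elim n)
    show ?case
    proof (intro allI impI)
      fix P :: "nat \<Rightarrow> nat" and p :: real
      assume parts: "\<forall>i<6. \<eta> * real n \<le> real (card {x. x < n \<and> P x = i})" and p: "0 \<le> p" "p \<le> 1"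
      let ?E = "all_edges n" and ?C = "cross_pairs n P"
      define s where "s = K * (real n * sqrt (real n))"
      define d where "d = \<delta> * (real n)\<^sup>2"
      have s: "2 * real k * s \<le> d / 2" using elim(1) by (simp add: s_def d_def)
      from cont[rule_format, of "{..<n}" n "red_triples n P"] elim(2) obtain FR where
        FR: "\<forall>S S'. (\<forall>i<k. S i = S' i) \<longrightarrow> FR S = FR S'" and
        CR: "\<forall>I. I \<subseteq> {..<n} \<times> {..<n} \<longrightarrow> triangles (red_triples n P) I = {} \<longrightarrow>
          (\<exists>S. (\<forall>i. S i \<subseteq> I \<and> real (card (S i)) \<le> s) \<and>
            I \<subseteq> FR S \<union> (\<Union>i<k. S i) \<and> few_triangles \<delta> n (red_triples n P) (FR S))"
        unfolding s_def by auto
      from cont[rule_format, of "{..<n}" n "blue_triples n P"] elim(2) obtain FB where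
        FB: "\<forall>S S'. (\<forall>i<k. S i = S' i) \<longrightarrow> FB S = FB S'" and
        CB: "\<forall>I. I \<subseteq> {..<n} \<times> {..<n} \<longrightarrow> triangles (blue_triples n P) I = {} \<longrightarrow>
          (\<exists>S. (\<forall>i. S i \<subseteq> I \<and> real (card (S i)) \<le> s) \<and>
            I \<subseteq> FB S \<union> (\<Union>i<k. S i) \<and> few_triangles \<delta> n (blue_triples n P) (FB S))"
        unfolding s_def by auto
      define SR where "SR = (\<lambda>X (i::nat). {e \<in> ?C. i \<in> X {fst e, snd e}})"
      define SB where "SB = (\<lambda>X (i::nat). {e \<in> ?C. k + i \<in> X {fst e, snd e}})"
      define supp where "supp = (\<lambda>X :: nat set \<Rightarrow> nat set. {e \<in> ?E. X e \<noteq> {}})"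
      define D where "D = (\<lambda>X. (\<lambda>e. {fst e, snd e}) ` (?C - (FR (SR X) \<union> FB (SB X))) - supp X)"
      define \<X> where "\<X> = {X \<in> PiE ?E (\<lambda>_. Pow {..<2*k}). real (card (supp X)) \<le> 2 * real k * s \<and> d / 2 \<le> real (card (D X))}"
      have fin: "finite (PiE ?E (\<lambda>_. Pow {..<2*k}))" using finite_all_edges by (intro finite_PiE) auto
      then have fin\<X>: "finite \<X>" by (simp add: \<X>_def)
      have DE: "D X \<subseteq> ?E" "supp X \<subseteq> ?E" "supp X \<inter> D X = {}" for X
        using cross_pair_edge[of _ n P] by (auto simp: D_def supp_def)
      let ?G = "binomial_random_graph n p"
      have "{G. \<not> forces_on_parts n P G} \<subseteq> (\<Union>X\<in>\<X>. {G. supp X \<subseteq> G \<and> D X \<inter> G = {}})"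
      proof
        fix G assume "G \<in> {G. \<not> forces_on_parts n P G}"
        then have G: "\<not> forces_on_parts n P G" by simp
        have "\<exists>X\<in>PiE ?E (\<lambda>_. Pow {..<2*k}).
          real (card (supp X)) \<le> 2 * real k * s \<and> supp X \<subseteq> G \<and>
          real (card (D X)) \<ge> d - 2 * real k * s \<and> D X \<inter> G = {}"
          unfolding supp_def D_def SR_def SB_def
          by (rule containers_of_non_forcing[OF FR[rule_format] FB[rule_format] CR[rule_format] CB[rule_format] _ G])
             (use many_uncovered_pairs[OF \<eta>(1) \<delta>_def elim(2)] parts in \<open>auto simp: d_def\<close>)
        then obtain X where X: "X \<in> PiE ?E (\<lambda>_. Pow {..<2*k})" "real (card (supp X)) \<le> 2 * real k * s"
          "supp X \<subseteq> G" "real (card (D X)) \<ge> d - 2 * real k * s" "D X \<inter> G = {}" by blast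
        have "X \<in> \<X>" using X s by (simp add: \<X>_def)
        then show "G \<in> (\<Union>X\<in>\<X>. {G. supp X \<subseteq> G \<and> D X \<inter> G = {}})" using X by blast
      qed
      then have "measure_pmf.prob ?G {G. \<not> forces_on_parts n P G} \<le>
          measure_pmf.prob ?G (\<Union>X\<in>\<X>. {G. supp X \<subseteq> G \<and> D X \<inter> G = {}})"
        by (intro measure_pmf.finite_measure_mono) auto
      also have "\<dots> \<le> (\<Sum>X\<in>\<X>. measure_pmf.prob ?G {G. supp X \<subseteq> G \<and> D X \<inter> G = {}})"
        using fin\<X> by (intro measure_pmf.finite_measure_subadditive_finite) auto
      also have "\<dots> \<le> (\<Sum>X\<in>\<X>. exp (- p * (d/2)) * (1/y) powr (2 * real k * s) * (p * y) ^ card (supp X))"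
      proof (rule sum_mono)
        fix X assume X: "X \<in> \<X>"
        have "measure_pmf.prob ?G {G. supp X \<subseteq> G \<and> D X \<inter> G = {}} = p ^ card (supp X) * (1 - p) ^ card (D X)"
          by (rule prob_contains_avoids) (use DE p in auto)
        also have "\<dots> \<le> (p ^ card (supp X) * ((1/y) powr (2 * real k * s) * y ^ card (supp X))) * exp (- p * (d/2))"
        proof (intro mult_mono)
          \<comment> \<open>Inserting this factor lets the sum run over all labellings, where it factorises.\<close>
          have "1 \<le> (1/y) powr (2 * real k * s - real (card (supp X)))"
            using X y by (intro ge_one_powr_ge_zero) (auto simp: \<X>_def)
          also have "\<dots> = (1/y) powr (2 * real k * s) * y ^ card (supp X)"
            using y by (simp add: powr_diff powr_realpow power_divide)
          finally show "p ^ card (supp X) \<le> p ^ card (supp X) * ((1/y) powr (2 * real k * s) * y ^ card (supp X))"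
            using p by (simp add: mult_left_mono mult_le_cancel_left1)
          have "(1 - p) ^ card (D X) \<le> exp (- p) ^ card (D X)"
            using p exp_ge_add_one_self[of "-p"] by (intro power_mono) auto
          also have "\<dots> = exp (- p * real (card (D X)))" by (simp add: exp_of_nat_mult[symmetric] mult.commute)
          also have "\<dots> \<le> exp (- p * (d/2))"
          proof -
            have "p * (d/2) \<le> p * real (card (D X))"
              using X p by (intro mult_left_mono) (auto simp: \<X>_def)
            then show ?thesis by simp
          qed
          finally show "(1 - p) ^ card (D X) \<le> exp (- p * (d/2))" .
        qed (use p y in auto)
        finally show "measure_pmf.prob ?G {G. supp X \<subseteq> G \<and> D X \<inter> G = {}} \<le>
            exp (- p * (d/2)) * (1/y) powr (2 * real k * s) * (p * y) ^ card (supp X)"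
          by (simp add: power_mult_distrib mult_ac)
      qed
      also have "\<dots> = exp (- p * (d/2)) * (1/y) powr (2 * real k * s) * (\<Sum>X\<in>\<X>. (p * y) ^ card (supp X))"
        by (simp add: sum_distrib_left)
      also have "(\<Sum>X\<in>\<X>. (p * y) ^ card (supp X)) \<le> (\<Sum>X\<in>PiE ?E (\<lambda>_. Pow {..<2*k}). (p * y) ^ card (supp X))"
        using fin p y by (intro sum_mono2) (auto simp: \<X>_def)
      also have "\<dots> \<le> exp (2 ^ (2*k) * (p * y) * real (card ?E))"
        unfolding supp_def using p y by (intro sum_labellings_le finite_all_edges) auto
      also have "\<dots> \<le> exp (p * (d/4))"
      proof -
        have "2 ^ (2*k) * (p * y) * real (card ?E) \<le> 2 ^ (2*k) * (p * y) * (real n)\<^sup>2"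
          using p y card_all_edges_le by (intro mult_left_mono) auto
        also have "\<dots> = p * (d/4)" by (simp add: y_def d_def power_mult)
        finally show ?thesis by simp
      qed
      finally have "measure_pmf.prob ?G {G. \<not> forces_on_parts n P G} \<le>
        exp (- p * (d/2)) * (1/y) powr (2 * real k * s) * exp (p * (d/4))"
        by (simp add: mult_left_mono)
      also have "(1/y) powr (2 * real k * s) = exp (2 * real k * s * ln (1/y))"
        using y by (simp add: powr_def)
      also have "exp (- p * (d/2)) * exp (2 * real k * s * ln (1/y)) * exp (p * (d/4)) =
          exp (2 * real k * s * ln (1/y) - p * (d/4))"
        by (simp add: exp_add[symmetric])
      also have "\<dots> \<le> exp (L * (real n * sqrt (real n)) - \<delta>/4 * p * (real n)\<^sup>2)"
        by (simp add: L_def s_def d_def algebra_simps)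
      finally show "measure_pmf.prob ?G {G. \<not> forces_on_parts n P G}
        \<le> exp (L * (real n * sqrt (real n)) - \<delta>/4 * p * (real n)\<^sup>2)" .
    qed
  qed
  then show ?thesis using \<delta> L by (intro exI[of _ "\<delta>/4"] exI[of _ L]) auto
qed

section \<open>Monochromatic tilings\<close>

lemma is_triangle_insertI:
  assumes "x \<noteq> y" "x \<noteq> z" "y \<noteq> z" "{x,y} \<in> E" "{x,z} \<in> E" "{y,z} \<in> E"
  shows "is_triangle E {x,y,z}"
  unfolding is_triangle_def
proof (intro conjI subsetI)
  fix e assume "e \<in> {e. e \<subseteq> {x, y, z} \<and> card e = 2}"
  then obtain a b where "e = {a,b}" "a \<noteq> b" "e \<subseteq> {x,y,z}" by (auto simp: card_2_iff)
  then show "e \<in> E" using assms by (auto simp: insert_commute)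
qed (use assms in auto)

lemma is_triangle_finite: "is_triangle E t \<Longrightarrow> finite t"
  by (rule card_ge_0_finite) (simp add: is_triangle_def)

lemma ex_three_parts:
  assumes "finite R" "3 * m \<le> card R"
  shows "\<exists>f :: 'a \<Rightarrow> nat. (\<forall>x. f x < 3) \<and> (\<forall>i<3. m \<le> card {x\<in>R. f x = i})"
proof -
  obtain A where A: "A \<subseteq> R" "card A = m" "finite A"
    using obtain_subset_with_card_n[of m R] assms by auto
  have cA: "card (R - A) = card R - m" using A assms by (simp add: card_Diff_subset)
  then have "m \<le> card (R - A)" using assms by linarith
  from obtain_subset_with_card_n[OF this]
  obtain B where B: "B \<subseteq> R - A" "card B = m" "finite B" by blast
  have cB: "card (R - A - B) = card R - m - m" using B assms cA by (simp add: card_Diff_subset)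
  define f where "f x = (if x \<in> A then 0 else if x \<in> B then 1 else 2::nat)" for x
  have "m \<le> card {x\<in>R. f x = i}" if "i < 3" for i
  proof -
    have "i = 0 \<or> i = 1 \<or> i = 2" using that by linarith
    then consider "i = 0" | "i = 1" | "i = 2" by blast
    then show ?thesis
    proof cases
      case 1
      have "{x\<in>R. f x = 0} = A" using A by (auto simp: f_def)
      then show ?thesis using 1 A by simp
    next
      case 2
      have "{x\<in>R. f x = 1} = B" using B by (auto simp: f_def)
      then show ?thesis using 2 B by simp
    next
      case 3
      have "{x\<in>R. f x = 2} = R - A - B" by (auto simp: f_def)
      then show ?thesis using 3 cB assms by simp
    qed
  qed
  then show ?thesis by (intro exI[of _ f]) (auto simp: f_def)
qed

text \<open>The only property of the random graph that the deterministic part uses. It ranges over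
  all large R and B, which there depend on the colouring and on earlier deletions.\<close>

definition cross_forcing :: "nat \<Rightarrow> nat \<Rightarrow> nat set set \<Rightarrow> (nat set \<Rightarrow> colour) \<Rightarrow> bool" where
  "cross_forcing n h G c \<longleftrightarrow> (\<forall>R B. R \<subseteq> {..<n} \<longrightarrow> B \<subseteq> {..<n} \<longrightarrow> R \<inter> B = {} \<longrightarrow>
     h \<le> card R \<longrightarrow> h \<le> card B \<longrightarrow>
     (\<exists>t \<subseteq> R \<union> B. is_triangle {e\<in>G. c e = Red} t \<and> \<not> t \<subseteq> R \<or>
                   is_triangle {e\<in>G. c e = Blue} t \<and> \<not> t \<subseteq> B))"

text \<open>R is cut into classes 0, 1, 2 and B into 3, 4, 5, everything else getting label 6; a red
  triangle reaching class 3 or higher then leaves R. Seven labels suffice, so only 7 ^ n partitions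
  have to be controlled.\<close>

lemma cross_forcing_if_forces_on_parts:
  assumes "\<And>P. P \<in> PiE {..<n} (\<lambda>_. {..6}) \<Longrightarrow> (\<forall>i<6. m \<le> card {x. x < n \<and> P x = i}) \<Longrightarrow>
    forces_on_parts n P G"
  shows "cross_forcing n (3 * m) G c"
  unfolding cross_forcing_def
proof (intro allI impI)
  fix R B :: "nat set"
  assume R: "R \<subseteq> {..<n}" and B: "B \<subseteq> {..<n}" and disj: "R \<inter> B = {}"
    and cR: "3 * m \<le> card R" and cB: "3 * m \<le> card B"
  have fin: "finite R" "finite B" using R B finite_subset by auto
  obtain f :: "nat \<Rightarrow> nat" where f: "\<And>x. f x < 3" "\<And>i. i < 3 \<Longrightarrow> m \<le> card {x\<in>R. f x = i}"
    using ex_three_parts[OF fin(1) cR] by auto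
  obtain g :: "nat \<Rightarrow> nat" where g: "\<And>x. g x < 3" "\<And>i. i < 3 \<Longrightarrow> m \<le> card {x\<in>B. g x = i}"
    using ex_three_parts[OF fin(2) cB] by auto
  define P where "P = restrict (\<lambda>x. if x \<in> R then f x else if x \<in> B then 3 + g x else 6) {..<n}"
  have PR: "P x = f x" if "x \<in> R" for x using that R by (auto simp: P_def)
  have PB: "P x = 3 + g x" if "x \<in> B" for x using that B disj by (auto simp: P_def)
  have PN: "P x = 6" if "x < n" "x \<notin> R" "x \<notin> B" for x using that by (auto simp: P_def)
  have "P x \<le> 6" if "x < n" for x
    using PR[of x] PB[of x] PN[of x] f(1)[of x] g(1)[of x] that by (cases "x \<in> R"; cases "x \<in> B") auto
  then have "P \<in> PiE {..<n} (\<lambda>_. {..6})" by (auto simp: P_def PiE_iff)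
  moreover have "m \<le> card {x. x < n \<and> P x = i}" if "i < 6" for i
  proof (cases "i < 3")
    case True
    have "{x\<in>R. f x = i} \<subseteq> {x. x < n \<and> P x = i}" using PR R by auto
    then have "card {x\<in>R. f x = i} \<le> card {x. x < n \<and> P x = i}" by (intro card_mono) auto
    then show ?thesis using f(2)[OF True] by linarith
  next
    case False
    have "{x\<in>B. g x = i - 3} \<subseteq> {x. x < n \<and> P x = i}" using PB B False by auto
    then have "card {x\<in>B. g x = i - 3} \<le> card {x. x < n \<and> P x = i}" by (intro card_mono) auto
    then show ?thesis using g(2)[of "i - 3"] that False by linarith
  qed
  ultimately have "forces_on_parts n P G" using assms by blast
  then obtain x y z where xyz: "x < n" "y < n" "z < n" "P x < P y" "P y < P z" "P z < 6"
    "{x,y} \<in> G" "{x,z} \<in> G" "{y,z} \<in> G"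
    and or: "c {x,y} = Red \<and> c {x,z} = Red \<and> c {y,z} = Red \<and> 3 \<le> P z \<or>
      c {x,y} = Blue \<and> c {x,z} = Blue \<and> c {y,z} = Blue \<and> P x < 3"
    unfolding forces_on_parts_def by (elim allE[of _ c] exE conjE) (rule that)
  have ne: "x \<noteq> y" "x \<noteq> z" "y \<noteq> z" using xyz by auto
  have inRB: "v \<in> R \<union> B" if "v < n" "P v < 6" for v using PN[of v] that by fastforce
  have sub: "{x,y,z} \<subseteq> R \<union> B" using inRB[of x] inRB[of y] inRB[of z] xyz by auto
  from or show "\<exists>t \<subseteq> R \<union> B. is_triangle {e\<in>G. c e = Red} t \<and> \<not> t \<subseteq> R \<or>
                   is_triangle {e\<in>G. c e = Blue} t \<and> \<not> t \<subseteq> B"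
  proof
    assume a: "c {x,y} = Red \<and> c {x,z} = Red \<and> c {y,z} = Red \<and> 3 \<le> P z"
    have "z \<notin> R" using PR[of z] f(1)[of z] a by auto
    moreover have "is_triangle {e\<in>G. c e = Red} {x,y,z}"
      by (rule is_triangle_insertI) (use ne a xyz in auto)
    ultimately show ?thesis using sub by (intro exI[of _ "{x,y,z}"]) auto
  next
    assume a: "c {x,y} = Blue \<and> c {x,z} = Blue \<and> c {y,z} = Blue \<and> P x < 3"
    have "x \<notin> B" using PB[of x] a by auto
    moreover have "is_triangle {e\<in>G. c e = Blue} {x,y,z}"
      by (rule is_triangle_insertI) (use ne a xyz in auto)
    ultimately show ?thesis using sub by (intro exI[of _ "{x,y,z}"]) auto
  qed
qed

section \<open>Greedy deletion of triangles\<close>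

lemma K3_tiling_insert:
  assumes T: "K3_tiling E T" "\<Union>T \<subseteq> W - t" and t: "is_triangle E t" "t \<subseteq> U" "U \<subseteq> W"
  shows "K3_tiling E (insert t T) \<and> \<Union>(insert t T) \<subseteq> W \<and> card (insert t T) = Suc (card T)"
proof -
  have "t \<noteq> {}" using t(1) by (auto simp: is_triangle_def)
  then have "t \<notin> T" using T(2) by blast
  moreover have "disjoint (insert t T)"
    using T by (auto simp: K3_tiling_def disjoint_def pairwise_def disjnt_def)
  ultimately show ?thesis using T t by (auto simp: K3_tiling_def)
qed

text \<open>An arbitrary split of W into two large sets will do, since only the existence of a
  monochromatic triangle is wanted.\<close>

lemma cross_forcing_halves:
  assumes cf: "cross_forcing n h G c" and W: "W \<subseteq> {..<n}" "2 * h \<le> card W"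
  shows "\<exists>k. \<exists>t\<subseteq>W. is_triangle {e\<in>G. c e = k} t"
proof -
  have fin: "finite W" using W finite_subset by auto
  obtain A where A: "A \<subseteq> W" "card A = h" "finite A"
    using obtain_subset_with_card_n[of h W] W by auto
  have "h \<le> card (W - A)" using A W fin by (simp add: card_Diff_subset)
  then have "\<exists>t \<subseteq> A \<union> (W - A). is_triangle {e\<in>G. c e = Red} t \<and> \<not> t \<subseteq> A \<or>
                   is_triangle {e\<in>G. c e = Blue} t \<and> \<not> t \<subseteq> W - A"
    using cf[unfolded cross_forcing_def, rule_format, of A "W - A"] A W by auto
  moreover have "A \<union> (W - A) = W" using A by blast
  ultimately show ?thesis by auto
qed

text \<open>Triangles are removed until fewer than 2 * h vertices remain; the hypothesis on W forces
  them all to have colour k.\<close>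

lemma greedy_tiling:
  assumes cf: "cross_forcing n h G c" and W: "W \<subseteq> {..<n}"
    and mono: "\<And>k' t. t \<subseteq> W \<Longrightarrow> is_triangle {e\<in>G. c e = k'} t \<Longrightarrow> k' = k"
  shows "\<exists>T. K3_tiling {e\<in>G. c e = k} T \<and> \<Union>T \<subseteq> W \<and> card W \<le> 3 * card T + 2 * h"
  using W mono
proof (induction "card W" arbitrary: W rule: less_induct)
  case less
  have fin: "finite W" by (rule finite_subset[OF less.prems(1)]) simp
  show ?case
  proof (cases "2 * h \<le> card W")
    case False
    then show ?thesis by (intro exI[of _ "{}"]) (auto simp: K3_tiling_def)
  next
    case True
    obtain k' t where t: "t \<subseteq> W" "is_triangle {e\<in>G. c e = k'} t"
      using cross_forcing_halves[OF cf less.prems(1) True] by auto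
    have "k' = k" using less.prems(2) t by blast
    then have t2: "is_triangle {e\<in>G. c e = k} t" using t by simp
    have c3: "card t = 3" using t2 by (simp add: is_triangle_def)
    have cW: "card (W - t) = card W - 3" "3 \<le> card W"
      using t(1) c3 fin card_mono[OF fin t(1)] is_triangle_finite[OF t2] by (auto simp: card_Diff_subset)
    have "\<exists>T. K3_tiling {e\<in>G. c e = k} T \<and> \<Union>T \<subseteq> W - t \<and> card (W - t) \<le> 3 * card T + 2 * h"
    proof (rule less.hyps)
      show "card (W - t) < card W" using cW by simp
      show "W - t \<subseteq> {..<n}" using less.prems by auto
      show "k' = k" if "t' \<subseteq> W - t" "is_triangle {e\<in>G. c e = k'} t'" for k' t'
        using less.prems(2) that by blast
    qed
    then obtain T where T: "K3_tiling {e\<in>G. c e = k} T" "\<Union>T \<subseteq> W - t" "card (W - t) \<le> 3 * card T + 2 * h"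
      by blast
    from K3_tiling_insert[OF T(1,2) t2 t(1) order_refl] T(3) cW show ?thesis
      by (intro exI[of _ "insert t T"]) auto
  qed
qed

text \<open>A red and a blue triangle with a common vertex use at most 3 + 3 - 1 = 5 vertices and
  advance both tilings by one. Both tilings are carried along because the colour that takes up the
  rest is known only at the end; they may overlap each other, since just one will be kept.\<close>

lemma mono_tilings:
  assumes cf: "cross_forcing n h G c" and W: "W \<subseteq> {..<n}"
  shows "\<exists>TR TB. K3_tiling {e\<in>G. c e = Red} TR \<and> \<Union>TR \<subseteq> W \<and> K3_tiling {e\<in>G. c e = Blue} TB \<and> \<Union>TB \<subseteq> W \<and>
    (card W \<le> 5 * card TR + 4 * h \<or> card W \<le> 5 * card TB + 4 * h)"
  using W
proof (induction "card W" arbitrary: W rule: less_induct)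
  case less
  have fin: "finite W" by (rule finite_subset[OF less.prems(1)]) simp
  let ?red = "is_triangle {e\<in>G. c e = Red}" and ?blue = "is_triangle {e\<in>G. c e = Blue}"
  show ?case
  proof (cases "\<exists>t t'. t \<subseteq> W \<and> t' \<subseteq> W \<and> ?red t \<and> ?blue t' \<and> t \<inter> t' \<noteq> {}")
    case True
    then obtain t t' where t: "t \<subseteq> W" "t' \<subseteq> W" "?red t" "?blue t'" "t \<inter> t' \<noteq> {}" by blast
    have f: "finite t" "finite t'" using t is_triangle_finite by blast+
    have c3: "card t = 3" "card t' = 3" using t by (auto simp: is_triangle_def)
    have "card (t \<inter> t') > 0" using t f by (simp add: card_gt_0_iff)
    then have c5: "card (t \<union> t') \<le> 5" using card_Un_Int[OF f] c3 by linarith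
    have c1: "0 < card (t \<union> t')" using c3 f t by (simp add: card_gt_0_iff) auto
    have cW: "card (W - (t \<union> t')) = card W - card (t \<union> t')" "card (t \<union> t') \<le> card W"
      using t f fin by (auto simp: card_Diff_subset card_mono)
    have "\<exists>TR TB. K3_tiling {e\<in>G. c e = Red} TR \<and> \<Union>TR \<subseteq> W - (t \<union> t') \<and>
      K3_tiling {e\<in>G. c e = Blue} TB \<and> \<Union>TB \<subseteq> W - (t \<union> t') \<and>
      (card (W - (t \<union> t')) \<le> 5 * card TR + 4 * h \<or> card (W - (t \<union> t')) \<le> 5 * card TB + 4 * h)"
      by (rule less.hyps) (use cW c1 less.prems in auto)
    then obtain TR TB where
      T: "K3_tiling {e\<in>G. c e = Red} TR" "\<Union>TR \<subseteq> W - (t \<union> t')"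
        "K3_tiling {e\<in>G. c e = Blue} TB" "\<Union>TB \<subseteq> W - (t \<union> t')"
        "card (W - (t \<union> t')) \<le> 5 * card TR + 4 * h \<or> card (W - (t \<union> t')) \<le> 5 * card TB + 4 * h"
      by (elim exE conjE) (rule that)
    have a: "\<Union>TR \<subseteq> W - t" "\<Union>TB \<subseteq> W - t'" using T by blast+
    from K3_tiling_insert[OF T(1) a(1) t(3,1) order_refl] K3_tiling_insert[OF T(3) a(2) t(4,2) order_refl]
    show ?thesis using T(5) c5 cW
      by (intro exI[of _ "insert t TR"] exI[of _ "insert t' TB"]) auto
  next
    case False
    have empty: "K3_tiling E {}" for E :: "nat set set" by (simp add: K3_tiling_def)
    \<comment> \<open>Vertices in no monochromatic triangle go to R. Every vertex of B lies in a
      blue triangle, so a red triangle through it would give an intersecting pair.\<close>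
    define R where "R = {v\<in>W. \<not> (\<exists>t\<subseteq>W. ?blue t \<and> v \<in> t)}"
    define B where "B = W - R"
    have RB: "R \<subseteq> {..<n}" "B \<subseteq> {..<n}" "R \<inter> B = {}" "R \<union> B = W"
      using less.prems by (auto simp: R_def B_def)
    have noR: "\<not> ?blue t" if "t \<subseteq> W" "v \<in> t" "v \<in> R" for t v
      using that by (auto simp: R_def)
    have noB: "\<not> ?red t" if t: "t \<subseteq> W" "v \<in> t" "v \<in> B" for t v
    proof
      assume r: "?red t"
      obtain t' where "t' \<subseteq> W" "?blue t'" "v \<in> t'" using t(3) by (auto simp: R_def B_def)
      then show False using False r t by blast
    qed
    have nonempty: "t \<noteq> {}" if "is_triangle E t" for E and t :: "nat set" using that by (auto simp: is_triangle_def)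
    have cWRB: "card W = card R + card B" using RB fin by (metis card_Un_disjoint finite_Un)
    show ?thesis
    proof (cases "h \<le> card R \<and> h \<le> card B")
      case True
      \<comment> \<open>Red triangles in W miss B and blue ones miss R, which
        \<open>cross_forcing\<close> rules out when both sets are large.\<close>
      then obtain t where t: "t \<subseteq> W" "?red t \<and> \<not> t \<subseteq> R \<or> ?blue t \<and> \<not> t \<subseteq> B"
        using cf[unfolded cross_forcing_def, rule_format, of R B] RB by auto
      then have False using noR noB RB(4) by blast
      then show ?thesis ..
    next
      case small: False
      show ?thesis
      proof (cases "h \<le> card R")
        case True
        \<comment> \<open>The small side has fewer than h vertices and the tiling of the other
          leaves at most 2 * h, so the total loss stays below 4 * h; three vertices per triangle is
          within the allowance of five.\<close>
        have "\<exists>T. K3_tiling {e\<in>G. c e = Red} T \<and> \<Union>T \<subseteq> R \<and> card R \<le> 3 * card T + 2 * h"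
        proof (rule greedy_tiling[OF cf RB(1)])
          fix k' t assume t: "t \<subseteq> R" "is_triangle {e \<in> G. c e = k'} t"
          show "k' = Red"
            using noR[of t] nonempty[OF t(2)] t RB(4) by (cases k') blast+
        qed
        then obtain T where "K3_tiling {e\<in>G. c e = Red} T" "\<Union>T \<subseteq> R" "card R \<le> 3 * card T + 2 * h" by blast
        then show ?thesis using empty[of "{e\<in>G. c e = Blue}"] small True cWRB RB(4)
          by (intro exI[of _ T] exI[of _ "{}"]) auto
      next
        case False
        have "\<exists>T. K3_tiling {e\<in>G. c e = Blue} T \<and> \<Union>T \<subseteq> B \<and> card B \<le> 3 * card T + 2 * h"
        proof (rule greedy_tiling[OF cf RB(2)])
          fix k' t assume t: "t \<subseteq> B" "is_triangle {e \<in> G. c e = k'} t"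
          show "k' = Blue"
            using noB[of t] nonempty[OF t(2)] t RB(4) by (cases k') blast+
        qed
        then obtain T where "K3_tiling {e\<in>G. c e = Blue} T" "\<Union>T \<subseteq> B" "card B \<le> 3 * card T + 2 * h" by blast
        then show ?thesis using empty[of "{e\<in>G. c e = Red}"] False cWRB RB(4)
          by (intro exI[of _ "{}"] exI[of _ T]) auto
      qed
    qed
  qed
qed

lemma K3_tiling_subset:
  assumes "K3_tiling E T" "T' \<subseteq> T"
  shows "K3_tiling E T'"
proof -
  have T: "finite T" "\<forall>t\<in>T. is_triangle E t" "disjoint T"
    using assms(1) by (simp_all add: K3_tiling_def)
  show ?thesis unfolding K3_tiling_def
    using finite_subset[OF assms(2) T(1)] T(2) pairwise_subset[OF T(3) assms(2)] assms(2) by auto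
qed

text \<open>The 4 on the right rounds (n - 4 * h) / 5 up: 5 * m \<le> 5 * card T + 4 still gives m
  \<le> card T. The tiling is cut down to exactly m triangles, as the definition asks.\<close>

lemma Rt_K3_ge:
  assumes G: "G \<subseteq> all_edges n" and cf: "\<And>c. cross_forcing n h G c" and m: "5 * m + 4 * h \<le> n + 4"
  shows "m \<le> Rt_K3 G"
proof -
  have "\<exists>k T. K3_tiling {e\<in>G. c e = k} T \<and> card T = m" for c :: "nat set \<Rightarrow> colour"
  proof -
    obtain TR TB where T: "K3_tiling {e\<in>G. c e = Red} TR" "\<Union>TR \<subseteq> {..<n}"
        "K3_tiling {e\<in>G. c e = Blue} TB" "\<Union>TB \<subseteq> {..<n}"
      and "card {..<n} \<le> 5 * card TR + 4 * h \<or> card {..<n} \<le> 5 * card TB + 4 * h"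
      using mono_tilings[OF cf[of c] order_refl] by (elim exE conjE) (rule that)
    then have "m \<le> card TR \<or> m \<le> card TB" using m by auto
    then obtain k T where kT: "K3_tiling {e\<in>G. c e = k} T" "m \<le> card T" using T(1,3) by metis
    obtain T' where "T' \<subseteq> T" "card T' = m" using obtain_subset_with_card_n[OF kT(2)] by auto
    then show ?thesis using K3_tiling_subset[OF kT(1)] by blast
  qed
  then have "forces_mono_K3_tiling G m" by (simp add: forces_mono_K3_tiling_def)
  then show ?thesis unfolding Rt_K3_def
    using finite_forces_mono_K3_tiling[OF finite_Union_graph[OF G]] by (intro Max_ge) auto
qed

section \<open>Union bound over vertex partitions and choice of constants\<close>

theorem theorem2p1:
  fixes \<epsilon> :: real
  assumes "\<epsilon> > 0"
  shows "\<exists>C::real. C > 0 \<and>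
    (\<forall>p :: nat \<Rightarrow> real.
       (\<forall>n. 0 \<le> p n \<and> p n \<le> 1) \<longrightarrow>
       (\<forall>\<^sub>F n in sequentially. p n \<ge> C * real n powr (-1/2)) \<longrightarrow>
       (\<lambda>n. measure_pmf.prob (binomial_random_graph n (p n))
              {G. real (Rt_K3 G) \<ge> real n / 5 - \<epsilon> * real n}) \<longlonglongrightarrow> 1)"
proof -
  \<comment> \<open>With h = 3 * m and m about \<eta> n, the loss 4 * h is about 12 * \<eta> * n
    \<le> 2 * \<epsilon> * n, less than the 5 * \<epsilon> * n available.\<close>
  define \<eta> where "\<eta> = min 1 (\<epsilon>/6)"
  have \<eta>: "0 < \<eta>" "\<eta> \<le> 1" "\<eta> \<le> \<epsilon>/6" using assms by (auto simp: \<eta>_def)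
  obtain \<delta> L where \<delta>: "\<delta> > 0" and L: "L > 0" and ev: "\<forall>\<^sub>F n in sequentially. \<forall>P p.
    (\<forall>i<6. \<eta> * real n \<le> real (card {x. x < n \<and> P x = i})) \<longrightarrow> 0 \<le> p \<longrightarrow> p \<le> 1 \<longrightarrow>
    measure_pmf.prob (binomial_random_graph n p) {G. \<not> forces_on_parts n P G}
      \<le> exp (L * (real n * sqrt (real n)) - \<delta> * p * (real n)\<^sup>2)"
    using prob_not_forces_on_parts[OF \<eta>(1,2)] by (elim exE conjE) (rule that)
  \<comment> \<open>This C gives \<delta> * p * n^2 \<ge> (L + 1) * n * sqrt n, leaving exp (- (n *
    sqrt n)) per partition, which beats 7 ^ n.\<close>
  show ?thesis
  proof (intro exI[of _ "(L + 1) / \<delta>"] conjI allI impI)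
    show "(L + 1) / \<delta> > 0" using \<delta> L by simp
    fix p :: "nat \<Rightarrow> real"
    assume p: "\<forall>n. 0 \<le> p n \<and> p n \<le> 1"
      and pC: "\<forall>\<^sub>F n in sequentially. p n \<ge> (L + 1) / \<delta> * real n powr (-1/2)"
    let ?prob = "\<lambda>n. measure_pmf.prob (binomial_random_graph n (p n)) {G. real (Rt_K3 G) \<ge> real n / 5 - \<epsilon> * real n}"
    \<comment> \<open>Rounding costs 5 for r and 12 for m, of which 4 is recovered in
      \<open>Rt_K3_ge\<close>; the spare 3 * \<epsilon> * n pays the other 13.\<close>
    have "\<forall>\<^sub>F n in sequentially. 13 \<le> 3 * \<epsilon> * real n" using assms by real_asymp
    with ev pC eventually_gt_at_top[of 0]
    have lower: "\<forall>\<^sub>F n in sequentially. 1 - 7 ^ n * exp (- (real n * sqrt (real n))) \<le> ?prob n"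
    proof eventually_elim
      case (elim n)
      let ?G = "binomial_random_graph n (p n)"
      define m where "m = nat \<lceil>\<eta> * real n\<rceil>"
      define \<P> where "\<P> = {P \<in> PiE {..<n} (\<lambda>_. {..6::nat}). \<forall>i<6. \<eta> * real n \<le> real (card {x. x < n \<and> P x = i})}"
      have fin: "finite (PiE {..<n} (\<lambda>_. {..6::nat}))" by (intro finite_PiE) auto
      have fin\<P>: "finite \<P>" using fin by (simp add: \<P>_def)
      have "card \<P> \<le> card (PiE {..<n} (\<lambda>_. {..6::nat}))" using fin by (intro card_mono) (auto simp: \<P>_def)
      then have c\<P>: "card \<P> \<le> 7 ^ n" by (simp add: card_PiE)
      define U where "U = (\<Union>P\<in>\<P>. {G. \<not> forces_on_parts n P G})"
      have exponent: "L * (real n * sqrt (real n)) - \<delta> * p n * (real n)\<^sup>2 \<le> - (real n * sqrt (real n))"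
      proof -
        define w where "w = sqrt (real n)"
        have w: "w > 0" "real n = w * w" using elim(3) by (auto simp: w_def)
        have pw: "real n powr (-1/2) = 1 / w"
          using elim(3) by (simp add: w_def powr_minus_divide powr_half_sqrt)
        have "\<delta> * ((L + 1) / \<delta> * (1 / w)) \<le> \<delta> * p n"
          using elim(2) \<delta> unfolding pw by (intro mult_left_mono) auto
        then have "(L + 1) / w \<le> \<delta> * p n" using \<delta> by simp
        then have "(L + 1) / w * (real n)\<^sup>2 \<le> \<delta> * p n * (real n)\<^sup>2" by (intro mult_right_mono) auto
        moreover have "(L + 1) / w * (real n)\<^sup>2 = (L + 1) * (real n * w)"
          using w by (simp add: power2_eq_square field_simps)
        ultimately show ?thesis by (simp add: w_def algebra_simps)
      qed
      have "measure_pmf.prob ?G U \<le> (\<Sum>P\<in>\<P>. measure_pmf.prob ?G {G. \<not> forces_on_parts n P G})"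
        unfolding U_def using fin\<P> by (intro measure_pmf.finite_measure_subadditive_finite) auto
      also have "\<dots> \<le> (\<Sum>P\<in>\<P>. exp (- (real n * sqrt (real n))))"
      proof (rule sum_mono)
        fix P assume "P \<in> \<P>"
        then have "measure_pmf.prob ?G {G. \<not> forces_on_parts n P G} \<le>
            exp (L * (real n * sqrt (real n)) - \<delta> * p n * (real n)\<^sup>2)"
          using elim(1) p by (simp add: \<P>_def)
        also have "\<dots> \<le> exp (- (real n * sqrt (real n)))" using exponent by simp
        finally show "measure_pmf.prob ?G {G. \<not> forces_on_parts n P G} \<le> exp (- (real n * sqrt (real n)))" .
      qed
      also have "\<dots> = real (card \<P>) * exp (- (real n * sqrt (real n)))" by simp
      also have "\<dots> \<le> 7 ^ n * exp (- (real n * sqrt (real n)))"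
      proof (rule mult_right_mono)
        have "real (card \<P>) \<le> real (7 ^ n)" using c\<P> by (rule of_nat_mono)
        then show "real (card \<P>) \<le> 7 ^ n" by simp
      qed simp
      finally have U: "measure_pmf.prob ?G U \<le> 7 ^ n * exp (- (real n * sqrt (real n)))" .
      have "real n / 5 - \<epsilon> * real n \<le> real (Rt_K3 G)" if G: "G \<in> set_pmf ?G" "G \<notin> U" for G
      proof (cases "real n / 5 - \<epsilon> * real n \<le> 0")
        case True
        then show ?thesis by (meson of_nat_0_le_iff order_trans)
      next
        case False
        \<comment> \<open>The target is positive here, so rounding up to a natural number adds at
          most 1.\<close>
        define r where "r = nat \<lceil>real n / 5 - \<epsilon> * real n\<rceil>"
        have GE: "G \<subseteq> all_edges n" using G(1) by (auto simp: binomial_random_graph_def)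
        have cf: "cross_forcing n (3 * m) G c" for c
        proof (rule cross_forcing_if_forces_on_parts)
          fix P assume P: "P \<in> PiE {..<n} (\<lambda>_. {..6::nat})" "\<forall>i<6. m \<le> card {x. x < n \<and> P x = i}"
          have "\<eta> * real n \<le> real m" unfolding m_def by linarith
          then have "\<forall>i<6. \<eta> * real n \<le> real (card {x. x < n \<and> P x = i})"
            using P(2) by (meson of_nat_mono order_trans)
          then have "P \<in> \<P>" using P(1) by (simp add: \<P>_def)
          then show "forces_on_parts n P G" using G(2) by (auto simp: U_def)
        qed
        have "0 \<le> \<eta> * real n" using \<eta> by simp
        then have "real m \<le> \<eta> * real n + 1" unfolding m_def by linarith
        moreover have "\<eta> * real n \<le> \<epsilon>/6 * real n" using \<eta> by (intro mult_right_mono) auto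
        ultimately have "real m \<le> \<epsilon> * real n / 6 + 1" by simp
        moreover have "real r \<le> real n / 5 - \<epsilon> * real n + 1" using False unfolding r_def by linarith
        ultimately have "5 * real r + 12 * real m \<le> real n + 4" using elim(4) by (simp add: field_simps)
        then have "5 * r + 4 * (3 * m) \<le> n + 4" by linarith
        from Rt_K3_ge[OF GE cf this] have "real r \<le> real (Rt_K3 G)" by simp
        moreover have "real n / 5 - \<epsilon> * real n \<le> real r" unfolding r_def by linarith
        ultimately show ?thesis by linarith
      qed
      \<comment> \<open>The bound on \<open>Rt_K3\<close> is known only for edge sets of graphs on n
        vertices, hence the restriction to the support.\<close>
      then have sub: "- U \<inter> set_pmf ?G \<subseteq> {G. real (Rt_K3 G) \<ge> real n / 5 - \<epsilon> * real n}" by auto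
      have "1 - measure_pmf.prob ?G U = measure_pmf.prob ?G (- U)"
        using measure_pmf.prob_compl[of U ?G] by (simp add: Compl_eq_Diff_UNIV)
      also have "\<dots> = measure_pmf.prob ?G (- U \<inter> set_pmf ?G)" by (simp add: measure_Int_set_pmf)
      also have "\<dots> \<le> ?prob n" using sub by (intro measure_pmf.finite_measure_mono) auto
      finally show ?case using U by linarith
    qed
    have lim: "(\<lambda>n::nat. 1 - 7 ^ n * exp (- (real n * sqrt (real n)))) \<longlonglongrightarrow> 1" by real_asymp
    show "?prob \<longlonglongrightarrow> 1"
      by (rule tendsto_sandwich[OF lower _ lim tendsto_const]) (auto simp: measure_pmf.prob_le_1)
  qed
qed

end
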